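(* Let $V$ be a group-like set. The following are equivalent: (1) the category $\mathcal{M}_V$ is directed; (2) $\mathrm{Homeo}(2^{\mathbb{N}},\mu_V)$ has the Rokhlin property, i.e. it admits a dense conjugacy class.
   Context: All measures are Borel probability measures; $2^{\mathbb{N}}$ is the Cantor space. A measure is full if it is positive on every nonempty open set; the clopen values set of $\mu$ is $V_\mu=\{\mu(U): U\text{ clopen}\}$. A full measure $\mu$ on $2^{\mathbb{N}}$ is good if whenever $U,W$ are clopen with $\mu(U)<\mu(W)$, there is a clopen $W'\subseteq W$ with $\mu(W')=\mu(U)$. A set $V$ is group-like if it is countably infinite, $\{0,1\}\subseteq V\subseteq[0,1]$, and $V+\mathbb{Z}$ is an additive subgroup of $\mathbb{R}$. For group-like $V$, $\mu_V$ denotes the good measure on $2^{\mathbb{N}}$ with clopen values set $V$ (it exists and is unique up to homeomorphism). $\mathrm{Homeo}(2^{\mathbb{N}},\mu_V)$ is the Polish group (compact-open topology) of homeomorphisms of $2^{\mathbb{N}}$ preserving $\mu_V$. A clopen partition is a finite partition of $2^{\mathbb{N}}$ into nonempty clopen sets. For clopen partitions $P,R$, a $\mu_V$-morphism $R\to P$ is a surjection $p\colon R\to P$ with $\mu_V(x)=\sum_{y\in p^{-1}(\{x\})}\mu_V(y)$ for all $x\in P$. The category $\mathcal{M}_V$: objects are matrices $A=(a_{p,p'})_{p,p'\in P}$ with entries in $V$, indexed by a clopen partition $P=P_A$ of $2^{\mathbb{N}}$, such that $\sum_{p'\in P}a_{p,p'}=\sum_{p'\in P}a_{p',p}=\mu_V(p)$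 for all $p\in P$ (so all entries sum to $1$). A morphism from $B=(b_{q,q'})_{q,q'\in Q}$ to $A=(a_{p,p'})_{p,p'\in P}$ is a $\mu_V$-morphism $f\colon Q\to P$ such that $a_{p,p'}=\sum_{q\in f^{-1}(p),\,q'\in f^{-1}(p')}b_{q,q'}$ for all $p,p'\in P$. A category is directed if for any two objects $A_0,A_1$ there are an object $B$ and morphisms $B\to A_0$, $B\to A_1$. *)

theory Defs
  imports "HOL-Analysis.Analysis" "HOL-Probability.Probability_Measure" "HOL-Algebra.Group"
begin

section \<open>Clopen values and good measures\<close>

text \<open>The topological space instance for function types is the product topology, and \<open>bool\<close> is
  discrete, so this type is the Cantor space.\<close>

type_synonym cantor = "nat \<Rightarrow> bool"

definition clopen :: "'a::topological_space set \<Rightarrow> bool" where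
  "clopen U \<longleftrightarrow> open U \<and> closed U"

definition borel_prob_measure :: "'a::topological_space measure \<Rightarrow> bool" where
  "borel_prob_measure \<mu> \<longleftrightarrow> sets \<mu> = sets borel \<and> prob_space \<mu>"

definition full_measure :: "'a::topological_space measure \<Rightarrow> bool" where
  "full_measure \<mu> \<longleftrightarrow>
     borel_prob_measure \<mu> \<and> (\<forall>U. open U \<longrightarrow> U \<noteq> {} \<longrightarrow> measure \<mu> U > 0)"

definition clopen_values :: "'a::topological_space measure \<Rightarrow> real set" where
  "clopen_values \<mu> = {measure \<mu> U | U. clopen U}"

definition good_measure :: "cantor measure \<Rightarrow> bool" where
  "good_measure \<mu> \<longleftrightarrow> full_measure \<mu> \<and>
     (\<forall>U W. clopen U \<longrightarrow> clopen W \<longrightarrow> measure \<mu> U < measure \<mu> W \<longrightarrow>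
        (\<exists>W'. clopen W' \<and> W' \<subseteq> W \<and> measure \<mu> W' = measure \<mu> U))"

definition additive_subgroup_of_reals :: "real set \<Rightarrow> bool" where
  "additive_subgroup_of_reals G \<longleftrightarrow>
     0 \<in> G \<and> (\<forall>x\<in>G. \<forall>y\<in>G. x + y \<in> G) \<and> (\<forall>x\<in>G. - x \<in> G)"

definition group_like :: "real set \<Rightarrow> bool" where
  "group_like V \<longleftrightarrow> countable V \<and> infinite V \<and> {0, 1} \<subseteq> V \<and> V \<subseteq> {0..1} \<and>
     additive_subgroup_of_reals {v + of_int k | v k. v \<in> V}"


section \<open>Directed categories\<close>

record ('o, 'm) category =
  Ob :: "'o set"
  Mor :: "'o \<Rightarrow> 'o \<Rightarrow> 'm set"
  Ident :: "'o \<Rightarrow> 'm"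
  Comp :: "'o \<Rightarrow> 'o \<Rightarrow> 'o \<Rightarrow> 'm \<Rightarrow> 'm \<Rightarrow> 'm"

text \<open>\<open>Mor C x y\<close> is the set of morphisms from \<open>x\<close> to \<open>y\<close>, and \<open>Comp C x y z g f\<close> is the composite
  of \<open>f\<close> from \<open>x\<close> to \<open>y\<close> followed by \<open>g\<close> from \<open>y\<close> to \<open>z\<close>.\<close>

definition is_category :: "('o, 'm) category \<Rightarrow> bool" where
  "is_category C \<longleftrightarrow>
     (\<forall>x\<in>Ob C. Ident C x \<in> Mor C x x) \<and>
     (\<forall>x\<in>Ob C. \<forall>y\<in>Ob C. \<forall>z\<in>Ob C. \<forall>f\<in>Mor C x y. \<forall>g\<in>Mor C y z.
        Comp C x y z g f \<in> Mor C x z) \<and>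
     (\<forall>x\<in>Ob C. \<forall>y\<in>Ob C. \<forall>f\<in>Mor C x y.
        Comp C x x y f (Ident C x) = f \<and> Comp C x y y (Ident C y) f = f) \<and>
     (\<forall>w\<in>Ob C. \<forall>x\<in>Ob C. \<forall>y\<in>Ob C. \<forall>z\<in>Ob C.
        \<forall>f\<in>Mor C w x. \<forall>g\<in>Mor C x y. \<forall>h\<in>Mor C y z.
        Comp C w y z h (Comp C w x y g f) = Comp C w x z (Comp C x y z h g) f)"

definition directed_category :: "('o, 'm) category \<Rightarrow> bool" where
  "directed_category C \<longleftrightarrow>
     (\<forall>A\<^sub>0\<in>Ob C. \<forall>A\<^sub>1\<in>Ob C. \<exists>B\<in>Ob C. Mor C B A\<^sub>0 \<noteq> {} \<and> Mor C B A\<^sub>1 \<noteq> {})"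


section \<open>The category of matrices\<close>

definition clopen_partition :: "cantor set set \<Rightarrow> bool" where
  "clopen_partition P \<longleftrightarrow> finite P \<and> partition_on UNIV P \<and> (\<forall>x\<in>P. clopen x)"

text \<open>Morphisms and matrices are extensional functions, so that each one is represented by exactly
  one HOL function.\<close>

definition measure_morphism ::
    "cantor measure \<Rightarrow> cantor set set \<Rightarrow> cantor set set \<Rightarrow> (cantor set \<Rightarrow> cantor set) \<Rightarrow> bool" where
  "measure_morphism \<mu> R P f \<longleftrightarrow> f \<in> R \<rightarrow>\<^sub>E P \<and> f ` R = P \<and>
     (\<forall>x\<in>P. measure \<mu> x = (\<Sum>y\<in>{y\<in>R. f y = x}. measure \<mu> y))"

type_synonym matrix_obj = "cantor set set \<times> (cantor set \<times> cantor set \<Rightarrow> real)"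

definition matrix_objects :: "real set \<Rightarrow> cantor measure \<Rightarrow> matrix_obj set" where
  "matrix_objects V \<mu> = {(P, a). clopen_partition P \<and> a \<in> P \<times> P \<rightarrow>\<^sub>E V \<and>
     (\<forall>p\<in>P. (\<Sum>p'\<in>P. a (p, p')) = measure \<mu> p \<and> (\<Sum>p'\<in>P. a (p', p)) = measure \<mu> p)}"

definition matrix_morphisms ::
    "cantor measure \<Rightarrow> matrix_obj \<Rightarrow> matrix_obj \<Rightarrow> (cantor set \<Rightarrow> cantor set) set" where
  "matrix_morphisms \<mu> = (\<lambda>(Q, b) (P, a). {f. measure_morphism \<mu> Q P f \<and>
     (\<forall>p\<in>P. \<forall>p'\<in>P. a (p, p') = (\<Sum>q\<in>{q\<in>Q. f q = p}. \<Sum>q'\<in>{q'\<in>Q. f q' = p'}. b (q, q')))})"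

definition matrix_category ::
    "real set \<Rightarrow> cantor measure \<Rightarrow> (matrix_obj, cantor set \<Rightarrow> cantor set) category" where
  "matrix_category V \<mu> =
     \<lparr>Ob = matrix_objects V \<mu>, Mor = matrix_morphisms \<mu>,
      Ident = (\<lambda>A. \<lambda>p\<in>fst A. p), Comp = (\<lambda>A B C g f. compose (fst A) g f)\<rparr>"

lemma sum_over_fibres_compose:
  fixes b :: "'a \<Rightarrow> real"
  assumes "finite Q" "finite P" "f ` Q \<subseteq> P"
  shows "(\<Sum>y\<in>{y\<in>P. g y = x}. \<Sum>q\<in>{q\<in>Q. f q = y}. b q) = (\<Sum>q\<in>{q\<in>Q. g (f q) = x}. b q)"
proof -
  have "(\<Sum>y\<in>{y\<in>P. g y = x}. \<Sum>q\<in>{q\<in>Q. f q = y}. b q)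
      = (\<Sum>y\<in>{y\<in>P. g y = x}. \<Sum>q\<in>{q\<in>{q\<in>Q. g (f q) = x}. f q = y}. b q)"
    by (intro sum.cong) auto
  also have "\<dots> = (\<Sum>q\<in>{q\<in>Q. g (f q) = x}. b q)"
    using assms by (intro sum.group) auto
  finally show ?thesis .
qed

lemma measure_morphism_compose:
  assumes "finite R" "finite Q" "measure_morphism \<mu> R Q f" "measure_morphism \<mu> Q P g"
  shows "measure_morphism \<mu> R P (compose R g f)"
proof -
  have f: "f \<in> R \<rightarrow>\<^sub>E Q" "f ` R = Q" "\<And>x. x \<in> Q \<Longrightarrow> measure \<mu> x = (\<Sum>y\<in>{y\<in>R. f y = x}. measure \<mu> y)"
    and g: "g \<in> Q \<rightarrow>\<^sub>E P" "g ` Q = P" "\<And>x. x \<in> P \<Longrightarrow> measure \<mu> x = (\<Sum>y\<in>{y\<in>Q. g y = x}. measure \<mu> y)"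
    using assms unfolding measure_morphism_def by auto
  have "measure \<mu> x = (\<Sum>y\<in>{y\<in>R. compose R g f y = x}. measure \<mu> y)" if "x \<in> P" for x
  proof -
    have "measure \<mu> x = (\<Sum>y\<in>{y\<in>Q. g y = x}. \<Sum>q\<in>{q\<in>R. f q = y}. measure \<mu> q)"
      unfolding g(3)[OF that] by (intro sum.cong refl f(3)) auto
    also have "\<dots> = (\<Sum>q\<in>{q\<in>R. g (f q) = x}. measure \<mu> q)"
      using assms f by (intro sum_over_fibres_compose) auto
    also have "\<dots> = (\<Sum>y\<in>{y\<in>R. compose R g f y = x}. measure \<mu> y)"
      by (intro sum.cong) (auto simp: compose_def)
    finally show ?thesis .
  qed
  moreover have "compose R g f \<in> R \<rightarrow>\<^sub>E P"
    using f(1) g(1) by (auto simp: compose_def PiE_iff)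
  moreover have "compose R g f ` R = P"
    using f(2) g(2) by (auto simp: compose_def image_image[symmetric])
  ultimately show ?thesis
    unfolding measure_morphism_def by blast
qed

lemma is_category_matrix_category: "is_category (matrix_category V \<mu>)"
proof -
  have ident: "(\<lambda>p\<in>P. p) \<in> matrix_morphisms \<mu> (P, a) (P, a)" for P a
  proof -
    have [simp]: "{q. (q \<in> P \<longrightarrow> q = p) \<and> q \<in> P} = {p}" if "p \<in> P" for p
      using that by auto
    show ?thesis
      by (auto simp: matrix_morphisms_def measure_morphism_def)
  qed
  have comp: "compose R g f \<in> matrix_morphisms \<mu> (R, c) (P, a)"
    if fin: "finite R" "finite Q"
      and f: "f \<in> matrix_morphisms \<mu> (R, c) (Q, b)"
      and g: "g \<in> matrix_morphisms \<mu> (Q, b) (P, a)" for R Q P c b a f g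
  proof -
    have ff: "f ` R = Q" and mf: "measure_morphism \<mu> R Q f" and mg: "measure_morphism \<mu> Q P g"
      and b: "\<And>q q'. q \<in> Q \<Longrightarrow> q' \<in> Q \<Longrightarrow>
        b (q, q') = (\<Sum>r\<in>{r\<in>R. f r = q}. \<Sum>r'\<in>{r'\<in>R. f r' = q'}. c (r, r'))"
      and a: "\<And>q q'. q \<in> P \<Longrightarrow> q' \<in> P \<Longrightarrow>
        a (q, q') = (\<Sum>r\<in>{r\<in>Q. g r = q}. \<Sum>r'\<in>{r'\<in>Q. g r' = q'}. b (r, r'))"
      using f g unfolding matrix_morphisms_def measure_morphism_def by auto
    have "a (p, p') = (\<Sum>r\<in>{r\<in>R. compose R g f r = p}. \<Sum>r'\<in>{r'\<in>R. compose R g f r' = p'}. c (r, r'))"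
      if "p \<in> P" "p' \<in> P" for p p'
    proof -
      have "a (p, p') = (\<Sum>q\<in>{q\<in>Q. g q = p}. \<Sum>q'\<in>{q'\<in>Q. g q' = p'}.
          \<Sum>r\<in>{r\<in>R. f r = q}. \<Sum>r'\<in>{r'\<in>R. f r' = q'}. c (r, r'))"
        unfolding a[OF that] by (intro sum.cong refl b) auto
      also have "\<dots> = (\<Sum>q\<in>{q\<in>Q. g q = p}. \<Sum>r\<in>{r\<in>R. f r = q}.
          \<Sum>q'\<in>{q'\<in>Q. g q' = p'}. \<Sum>r'\<in>{r'\<in>R. f r' = q'}. c (r, r'))"
        by (intro sum.cong refl sum.swap)
      also have "\<dots> = (\<Sum>r\<in>{r\<in>R. g (f r) = p}.
          \<Sum>q'\<in>{q'\<in>Q. g q' = p'}. \<Sum>r'\<in>{r'\<in>R. f r' = q'}. c (r, r'))"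
        using fin ff by (intro sum_over_fibres_compose) auto
      also have "\<dots> = (\<Sum>r\<in>{r\<in>R. g (f r) = p}. \<Sum>r'\<in>{r'\<in>R. g (f r') = p'}. c (r, r'))"
        using fin ff by (intro sum.cong refl sum_over_fibres_compose) auto
      also have "\<dots> = (\<Sum>r\<in>{r\<in>R. compose R g f r = p}. \<Sum>r'\<in>{r'\<in>R. compose R g f r' = p'}. c (r, r'))"
        by (intro sum.cong) (auto simp: compose_def)
      finally show ?thesis .
    qed
    then show ?thesis
      using measure_morphism_compose[OF fin mf mg] by (auto simp: matrix_morphisms_def)
  qed
  have fin: "finite P" if "(P, a) \<in> matrix_objects V \<mu>" for P a
    using that by (auto simp: matrix_objects_def clopen_partition_def)
  have comp': "compose R g f \<in> matrix_morphisms \<mu> (R, c) (P, a)"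
    if "(R, c) \<in> matrix_objects V \<mu>" "(Q, b) \<in> matrix_objects V \<mu>"
      "f \<in> matrix_morphisms \<mu> (R, c) (Q, b)" "g \<in> matrix_morphisms \<mu> (Q, b) (P, a)"
    for R Q P c b a f g
    using comp[OF fin[OF that(1)] fin[OF that(2)] that(3,4)] .
  have fun1: "f \<in> Q \<rightarrow>\<^sub>E P" if "f \<in> matrix_morphisms \<mu> (Q, b) (P, a)" for f P Q a b
    using that by (auto simp: matrix_morphisms_def measure_morphism_def)
  have left: "compose Q f (\<lambda>p\<in>Q. p) = f" "compose Q (\<lambda>p\<in>P. p) f = f"
    if "f \<in> matrix_morphisms \<mu> (Q, b) (P, a)" for f P Q a b
    using fun1[OF that] by (auto simp: compose_def fun_eq_iff PiE_iff extensional_def)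
  have assoc: "compose S h (compose S g f) = compose S (compose R h g) f"
    if "f \<in> matrix_morphisms \<mu> (S, d) (R, c)" for S R d c f g h
    using fun1[OF that] by (auto simp: compose_def fun_eq_iff PiE_iff)
  show ?thesis
    unfolding is_category_def matrix_category_def
    using ident left assoc comp' by auto
qed


section \<open>The homeomorphism group and the Rokhlin property\<close>

definition homeo :: "cantor measure \<Rightarrow> (cantor \<Rightarrow> cantor) set" where
  "homeo \<mu> = {f. homeomorphic_map euclidean euclidean f \<and> distr \<mu> \<mu> f = \<mu>}"

definition homeo_group :: "cantor measure \<Rightarrow> (cantor \<Rightarrow> cantor) monoid" where
  "homeo_group \<mu> = \<lparr>carrier = homeo \<mu>, mult = (\<circ>), one = id\<rparr>"

definition compact_open_topology :: "('a::topological_space \<Rightarrow> 'b::topological_space) topology" where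
  "compact_open_topology = topology_generated_by
     {{f. continuous_on UNIV f \<and> f ` K \<subseteq> U} | K U. compact K \<and> open U}"

definition homeo_topology :: "cantor measure \<Rightarrow> (cantor \<Rightarrow> cantor) topology" where
  "homeo_topology \<mu> = subtopology compact_open_topology (homeo \<mu>)"

definition conjugacy_class :: "('a, 'b) monoid_scheme \<Rightarrow> 'a \<Rightarrow> 'a set" where
  "conjugacy_class G x = {g \<otimes>\<^bsub>G\<^esub> x \<otimes>\<^bsub>G\<^esub> inv\<^bsub>G\<^esub> g | g. g \<in> carrier G}"

definition rokhlin_property :: "('a, 'b) monoid_scheme \<Rightarrow> 'a topology \<Rightarrow> bool" where
  "rokhlin_property G T \<longleftrightarrow>
     (\<exists>x\<in>carrier G. T closure_of conjugacy_class G x = topspace T)"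

lemma homeo_measurable:
  assumes "sets \<mu> = sets borel" "f \<in> homeo \<mu>"
  shows "f \<in> measurable \<mu> \<mu>"
proof -
  have "continuous_on UNIV f"
    using assms(2) homeomorphic_imp_continuous_map[of euclidean euclidean f]
    by (simp add: homeo_def)
  then show ?thesis
    unfolding measurable_cong_sets[OF assms(1) assms(1)] by (rule borel_measurable_continuous_onI)
qed

lemma group_homeo_group:
  assumes "sets \<mu> = sets borel"
  shows "group (homeo_group \<mu>)"
proof (rule groupI)
  fix f g assume fg: "f \<in> carrier (homeo_group \<mu>)" "g \<in> carrier (homeo_group \<mu>)"
  then have "distr \<mu> \<mu> (f \<circ> g) = distr (distr \<mu> \<mu> g) \<mu> f"
    using assms homeo_measurable by (intro distr_distr[symmetric]) (auto simp: homeo_group_def)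
  then show "f \<otimes>\<^bsub>homeo_group \<mu>\<^esub> g \<in> carrier (homeo_group \<mu>)"
    using fg by (auto simp: homeo_group_def homeo_def intro: homeomorphic_map_compose)
next
  show "\<one>\<^bsub>homeo_group \<mu>\<^esub> \<in> carrier (homeo_group \<mu>)"
    by (simp add: homeo_group_def homeo_def id_def homeomorphic_map_id[unfolded id_def])
next
  fix f assume "f \<in> carrier (homeo_group \<mu>)"
  then have f: "f \<in> homeo \<mu>" "homeomorphic_map euclidean euclidean f" "distr \<mu> \<mu> f = \<mu>"
    by (auto simp: homeo_group_def homeo_def)
  then obtain g where g: "homeomorphic_maps euclidean euclidean f g"
    by (auto simp: homeomorphic_map_maps)
  then have gf: "g \<circ> f = id" and gh: "homeomorphic_map euclidean euclidean g"
    by (auto simp: homeomorphic_maps_def fun_eq_iff homeomorphic_map_maps)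
  have "continuous_on UNIV g"
    using g by (simp add: homeomorphic_maps_def)
  then have gm: "g \<in> measurable \<mu> \<mu>"
    unfolding measurable_cong_sets[OF assms assms] by (rule borel_measurable_continuous_onI)
  have "distr \<mu> \<mu> g = distr (distr \<mu> \<mu> f) \<mu> g"
    using f by simp
  also have "\<dots> = distr \<mu> \<mu> (g \<circ> f)"
    using gm homeo_measurable[OF assms f(1)] by (rule distr_distr)
  also have "\<dots> = \<mu>"
    by (simp add: gf id_def)
  finally have "g \<in> homeo \<mu>"
    using gh by (simp add: homeo_def)
  then show "\<exists>g\<in>carrier (homeo_group \<mu>). g \<otimes>\<^bsub>homeo_group \<mu>\<^esub> f = \<one>\<^bsub>homeo_group \<mu>\<^esub>"
    using gf by (auto simp: homeo_group_def)
qed (auto simp: homeo_group_def o_assoc)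

lemma topspace_homeo_topology: "topspace (homeo_topology \<mu>) = carrier (homeo_group \<mu>)"
proof -
  have "topspace compact_open_topology = {f :: cantor \<Rightarrow> cantor. continuous_on UNIV f}"
    unfolding compact_open_topology_def topology_generated_by_topspace
  proof (intro equalityI Union_upper)
    show "{f :: cantor \<Rightarrow> cantor. continuous_on UNIV f}
        \<in> {{f. continuous_on UNIV f \<and> f ` K \<subseteq> U} | K U. compact K \<and> open U}"
      by (rule CollectI, rule exI[of _ "{}"], rule exI[of _ UNIV]) simp
  qed blast
  moreover have "homeo \<mu> \<subseteq> {f. continuous_on UNIV f}"
    using homeomorphic_imp_continuous_map[of euclidean euclidean] by (auto simp: homeo_def)
  ultimately show ?thesis
    by (auto simp: homeo_topology_def homeo_group_def)
qed

end

theory Submission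
  imports Defs
begin

text \<open>A homeomorphism \<open>h\<close> and a clopen partition \<open>P\<close> give the matrix \<open>\<mu> (p \<inter> h -` p')\<close>, and every object of
  the category arises in this way. Two homeomorphisms with the same matrix over \<open>P\<close> are, up to
  conjugation, indistinguishable on \<open>P\<close>, because goodness extends a measure-preserving matching of two
  clopen partitions to a homeomorphism. A morphism of matrices is realised by conjugation. Hence
  a conjugacy class is dense iff every matrix is realised by a conjugate of one fixed \<open>x\<close>. Given such an
  \<open>x\<close>, its matrix over a common refinement dominates any two matrices. Conversely, directedness
  allows one to change a homeomorphism, without altering it on finitely many clopen sets, so that a conjugate
  realises the next matrix of an enumeration; these changes converge to \<open>x\<close>.\<close>

section \<open>Clopen subsets of the Cantor space\<close>

text \<open>Two obstacles shape the proof. Goodness yields just one clopen subset of prescribed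
  measure at a time, while a homeomorphism is wanted. So two partitions are refined simultaneously
  into trees of clopen sets with equal measures, whose branches shrink to points; fullness makes
  corresponding nodes empty together, so the branches of the two trees match.

  A limit of homeomorphisms need not be invertible. Every stage therefore freezes images as well as
  preimages of finitely many clopen sets, which makes the inverses stabilise too. The conjugators
  need not converge: whether the conjugate of \<open>h\<close> by \<open>k\<close> realises a matrix
  over \<open>P\<close> depends only on the preimages of the parts of \<open>P\<close> under
  \<open>k\<close> and on the preimages of these under \<open>h\<close>. Once these finitely many
  sets are frozen, the same \<open>k\<close> serves every later stage and the limit.

  Topology is handled through coordinates: clopen means depending on finitely many of them.\<close>

definition determined :: "nat \<Rightarrow> cantor set \<Rightarrow> bool" where
  "determined N U \<longleftrightarrow> (\<forall>s t. (\<forall>i<N. s i = t i) \<longrightarrow> (s \<in> U \<longleftrightarrow> t \<in> U))"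

definition cylinder :: "nat \<Rightarrow> cantor \<Rightarrow> cantor set" where
  "cylinder N x = {t. \<forall>i<N. t i = x i}"

lemma determined_mono: "determined m U \<Longrightarrow> m \<le> n \<Longrightarrow> determined n U"
  unfolding determined_def by auto

lemma determinedD: "determined N U \<Longrightarrow> (\<And>i. i < N \<Longrightarrow> s i = t i) \<Longrightarrow> s \<in> U \<longleftrightarrow> t \<in> U"
  unfolding determined_def by blast

lemma determined_cylinder: "determined N (cylinder N x)"
  by (simp add: determined_def cylinder_def)

lemma clopen_empty [simp]: "clopen {}" and clopen_UNIV [simp]: "clopen UNIV"
  by (simp_all add: clopen_def)

lemma clopen_Int: "clopen U \<Longrightarrow> clopen W \<Longrightarrow> clopen (U \<inter> W)"
  and clopen_Diff: "clopen U \<Longrightarrow> clopen W \<Longrightarrow> clopen (U - W)"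
  and clopen_Compl: "clopen U \<Longrightarrow> clopen (- U)"
  by (auto simp: clopen_def)

lemma clopen_UN: "finite I \<Longrightarrow> (\<And>i. i \<in> I \<Longrightarrow> clopen (U i)) \<Longrightarrow> clopen (\<Union>i\<in>I. U i)"
  by (auto simp: clopen_def)

lemma clopen_vimage: "continuous_on UNIV f \<Longrightarrow> clopen U \<Longrightarrow> clopen (f -` U)"
  by (simp add: clopen_def open_vimage closed_vimage)

lemma clopen_coordinate: "clopen {t :: cantor. t i}"
proof -
  have "continuous_on UNIV (\<lambda>t :: cantor. t i)"
    by (rule continuous_on_product_then_coordinatewise) (rule continuous_on_id)
  moreover have "clopen {True}"
    by (simp add: clopen_def open_discrete closed_def)
  ultimately have "clopen ((\<lambda>t :: cantor. t i) -` {True})"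
    by (rule clopen_vimage)
  then show ?thesis
    by (simp add: vimage_def)
qed

lemma open_cylinder: "open (cylinder N x)"
proof -
  have "cylinder N x = (\<Inter>i\<in>{..<N}. if x i then {t. t i} else - {t. t i})"
    by (auto simp: cylinder_def split: if_splits)
  moreover have "open \<dots>"
    using clopen_coordinate clopen_Compl by (intro open_INT) (auto simp: clopen_def)
  ultimately show ?thesis by simp
qed

lemma open_contains_cylinder:
  assumes "open U" "x \<in> U"
  shows "\<exists>N. cylinder N x \<subseteq> U"
proof -
  have "openin (product_topology (\<lambda>i. euclidean) UNIV) U"
    using assms by (simp add: open_fun_def)
  from product_topology_open_contains_basis[OF this assms(2)]
  obtain X where X: "x \<in> (\<Pi>\<^sub>E i\<in>UNIV. X i)" "finite {i. X i \<noteq> (UNIV :: bool set)}" "(\<Pi>\<^sub>E i\<in>UNIV. X i) \<subseteq> U"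
    by auto
  obtain N where N: "\<And>i. X i \<noteq> UNIV \<Longrightarrow> i < N"
    using X(2) finite_nat_set_iff_bounded by auto
  have "cylinder N x \<subseteq> (\<Pi>\<^sub>E i\<in>UNIV. X i)"
  proof
    fix t assume t: "t \<in> cylinder N x"
    have "t i \<in> X i" for i
      using N[of i] X(1) t by (cases "X i = UNIV") (auto simp: cylinder_def PiE_iff)
    then show "t \<in> (\<Pi>\<^sub>E i\<in>UNIV. X i)" by auto
  qed
  then show ?thesis using X(3) by blast
qed

text \<open>Such a set is the union of the cylinders of length \<open>N\<close> around its points,
  and its complement is determined by the same coordinates.\<close>

lemma determined_imp_clopen:
  assumes "determined N U"
  shows "clopen U"
proof -
  have *: "open U" if "determined N U" for U
  proof -
    have "t \<in> U \<longleftrightarrow> x \<in> U" if "t \<in> cylinder N x" for t x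
      using that \<open>determined N U\<close> determinedD[of N U t x] by (simp add: cylinder_def)
    then have "(\<Union>x\<in>U. cylinder N x) = U"
      by (auto simp: cylinder_def)
    then show ?thesis
      by (metis open_UN open_cylinder)
  qed
  have "determined N (- U)"
    using assms by (simp add: determined_def)
  then show ?thesis
    using assms * by (simp add: clopen_def closed_def)
qed

lemma clopen_cylinder: "clopen (cylinder N x)"
  by (rule determined_imp_clopen[OF determined_cylinder])

lemma compact_UNIV_cantor: "compact (UNIV :: cantor set)"
proof -
  have "compact (UNIV :: bool set)"
    by (simp add: finite_imp_compact)
  then have "compact_space (product_topology (\<lambda>i::nat. euclidean :: bool topology) UNIV)"
    by (intro compact_space_product_topology[THEN iffD2]) (simp add: compact_space_def)
  then show ?thesis
    by (simp add: euclidean_product_topology compact_space_def)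
qed

lemma clopen_imp_compact: "clopen (U :: cantor set) \<Longrightarrow> compact U"
  using compact_Int_closed[OF compact_UNIV_cantor, of U] by (simp add: clopen_def)

text \<open>Every point has a cylinder inside \<open>U\<close> or inside its complement. By
  compactness finitely many of them cover the space, and a bound on their lengths serves as
  \<open>N\<close>.\<close>

lemma clopen_imp_determined:
  assumes "clopen U"
  shows "\<exists>N. determined N U"
proof -
  have "\<forall>x. \<exists>N. cylinder N x \<subseteq> U \<or> cylinder N x \<subseteq> - U"
    using assms open_contains_cylinder[of U] open_contains_cylinder[of "- U"]
    unfolding clopen_def by (metis ComplI open_Compl)
  then obtain N where N: "\<And>x. cylinder (N x) x \<subseteq> U \<or> cylinder (N x) x \<subseteq> - U"
    by metis
  have cover: "UNIV \<subseteq> (\<Union>x\<in>UNIV. cylinder (N x) x)"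
    by (auto simp: cylinder_def)
  obtain D where D: "finite D" "UNIV \<subseteq> (\<Union>x\<in>D. cylinder (N x) x)"
    by (rule compactE_image[OF compact_UNIV_cantor open_cylinder cover])
  obtain M where M: "\<And>x. x \<in> D \<Longrightarrow> N x \<le> M"
    using D(1) by (metis Max_ge finite_imageI imageI)
  have "s \<in> U \<longleftrightarrow> t \<in> U" if "\<And>i. i < M \<Longrightarrow> s i = t i" for s t
  proof -
    obtain x where x: "x \<in> D" "s \<in> cylinder (N x) x" using D by blast
    then have "t \<in> cylinder (N x) x"
      using M[OF x(1)] that by (auto simp: cylinder_def)
    then show ?thesis using x N[of x] by blast
  qed
  then show ?thesis unfolding determined_def by blast
qed

lemma clopens_determined:
  assumes "finite \<U>" "\<And>U. U \<in> \<U> \<Longrightarrow> clopen U"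
  shows "\<exists>N. \<forall>U\<in>\<U>. determined N U"
  using assms
proof (induction rule: finite_induct)
  case (insert U \<U>)
  then obtain M N where "\<forall>U\<in>\<U>. determined N U" "determined M U"
    using clopen_imp_determined by (metis insert_iff)
  then have "\<forall>W\<in>insert U \<U>. determined (max M N) W"
    using determined_mono by (metis insert_iff max.cobounded1 max.cobounded2)
  then show ?case by blast
qed simp

text \<open>By compactness, finitely many cylinders inside \<open>U\<close> cover \<open>K\<close>.
  This is what later replaces the pairs of the compact-open topology by clopen sets.\<close>

lemma clopen_between:
  fixes U :: "cantor set"
  assumes "compact K" "open U" "K \<subseteq> U"
  shows "\<exists>W. clopen W \<and> K \<subseteq> W \<and> W \<subseteq> U"
proof -
  obtain N where N: "\<And>x. x \<in> K \<Longrightarrow> cylinder (N x) x \<subseteq> U"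
    using open_contains_cylinder[OF assms(2)] assms(3) by (metis subsetD)
  have cover: "K \<subseteq> (\<Union>x\<in>K. cylinder (N x) x)"
    by (auto simp: cylinder_def)
  obtain D where D: "D \<subseteq> K" "finite D" "K \<subseteq> (\<Union>x\<in>D. cylinder (N x) x)"
    by (rule compactE_image[OF assms(1) open_cylinder cover])
  then show ?thesis
    using N by (intro exI[of _ "\<Union>x\<in>D. cylinder (N x) x"]) (auto intro!: clopen_UN clopen_cylinder)
qed

section \<open>Countability of the clopen algebra and generation of the Borel sets\<close>

definition restrict_bits :: "nat \<Rightarrow> cantor \<Rightarrow> cantor" where
  "restrict_bits N x = (\<lambda>i. i < N \<and> x i)"

lemma finite_range_restrict_bits: "finite (range (restrict_bits N))"
proof (rule finite_subset)
  show "range (restrict_bits N) \<subseteq> (\<lambda>A i. i \<in> A) ` Pow {..<N}"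
  proof
    fix y assume "y \<in> range (restrict_bits N)"
    then obtain x where x: "y = restrict_bits N x" by blast
    show "y \<in> (\<lambda>A i. i \<in> A) ` Pow {..<N}"
      by (rule image_eqI[of _ _ "{i. i < N \<and> x i}"]) (auto simp: x restrict_bits_def)
  qed
qed simp

lemma determined_restrict_bits: "determined N U \<Longrightarrow> restrict_bits N x \<in> U \<longleftrightarrow> x \<in> U"
  by (rule determinedD) (auto simp: restrict_bits_def)

text \<open>A set determined by the first \<open>N\<close> coordinates is recovered from the
  truncations of its points, of which there are finitely many.\<close>

lemma countable_clopen: "countable {U :: cantor set. clopen U}"
proof -
  have "{U. clopen U} \<subseteq> (\<Union>N. {U. determined N U})"
    using clopen_imp_determined by auto
  moreover have "finite {U. determined N U}" for N
  proof (rule finite_subset)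
    show "{U. determined N U} \<subseteq> (\<lambda>A. restrict_bits N -` A) ` Pow (range (restrict_bits N))"
    proof
      fix U assume "U \<in> {U. determined N U}"
      then have "U = restrict_bits N -` (restrict_bits N ` U)"
        by (auto simp: determined_restrict_bits) (metis determined_restrict_bits)
      then show "U \<in> (\<lambda>A. restrict_bits N -` A) ` Pow (range (restrict_bits N))"
        by blast
    qed
  qed (simp add: finite_range_restrict_bits)
  ultimately show ?thesis
    by (meson countable_UN countableI_type countable_finite countable_subset)
qed

text \<open>An open set is the union of its clopen subsets, and this union is countable.\<close>

lemma sets_borel_cantor: "sets (borel :: cantor measure) = sigma_sets UNIV {U. clopen U}"
proof
  have "U \<in> sigma_sets UNIV {U. clopen U}" if "open U" for U :: "cantor set"
  proof -
    have "x \<in> \<Union>{W. clopen W \<and> W \<subseteq> U}" if x: "x \<in> U" for x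
    proof -
      obtain N where "cylinder N x \<subseteq> U"
        using open_contains_cylinder[OF \<open>open U\<close> x] by blast
      then show ?thesis
        by (intro UnionI[of "cylinder N x"]) (simp_all add: clopen_cylinder, simp add: cylinder_def)
    qed
    then have "U = \<Union>{W. clopen W \<and> W \<subseteq> U}"
      by blast
    moreover have "\<Union>{W. clopen W \<and> W \<subseteq> U} \<in> sigma_sets UNIV {U. clopen U}"
    proof (rule sigma_sets_UNION)
      show "countable {W. clopen W \<and> W \<subseteq> U}"
        by (rule countable_subset[OF _ countable_clopen]) auto
    qed auto
    ultimately show ?thesis by simp
  qed
  then show "sets (borel :: cantor measure) \<subseteq> sigma_sets UNIV {U. clopen U}"
    unfolding borel_def by (auto intro!: sigma_sets_mono)
  show "sigma_sets UNIV {U. clopen U} \<subseteq> sets (borel :: cantor measure)"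
    unfolding borel_def by (auto simp: clopen_def intro!: sigma_sets_mono)
qed

text \<open>\<open>bool\<close> is discrete with only four subsets, so continuity of a coordinate
  comes down to one clopen set.\<close>

lemma continuous_on_UNIV_cantorI:
  fixes f :: "'a::topological_space \<Rightarrow> cantor"
  assumes "\<And>i. clopen {t. f t i}"
  shows "continuous_on UNIV f"
proof (rule continuous_on_coordinatewise_then_product)
  fix i
  have "open ((\<lambda>t. f t i) -` B)" for B
  proof -
    have "(\<lambda>t. f t i) -` B = {t. f t i \<and> True \<in> B} \<union> {t. \<not> f t i \<and> False \<in> B}"
    proof (rule Set.set_eqI)
      fix t show "t \<in> (\<lambda>t. f t i) -` B \<longleftrightarrow> t \<in> {t. f t i \<and> True \<in> B} \<union> {t. \<not> f t i \<and> False \<in> B}"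
        by (cases "f t i") auto
    qed
    moreover have "open {t. f t i \<and> True \<in> B}" "open {t. \<not> f t i \<and> False \<in> B}"
      using assms[of i] by (cases "True \<in> B"; cases "False \<in> B"; simp add: clopen_def closed_def Collect_neg_eq)+
    ultimately show ?thesis
      by auto
  qed
  then show "continuous_on UNIV (\<lambda>t. f t i)"
    by (simp add: continuous_on_open_vimage)
qed

section \<open>Binary schemes of clopen sets\<close>

text \<open>The depth \<open>N\<close> is uniform over roots and nodes, so that a clopen set can
  later be cut out at a single level. Empty nodes satisfy the condition vacuously.\<close>

definition separating :: "'i set \<Rightarrow> ('i \<Rightarrow> bool list \<Rightarrow> cantor set) \<Rightarrow> bool" where
  "separating I A \<longleftrightarrow>
     (\<forall>k. \<exists>N. \<forall>i\<in>I. \<forall>l. N \<le> length l \<longrightarrow> (\<forall>s\<in>A i l. \<forall>t\<in>A i l. s k = t k))"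

text \<open>A forest of binary trees, one for each \<open>i\<close>. A list is a path read
  backwards, with the latest branching at its head. Nodes may be empty, since a coordinate need not
  split a given node.\<close>

definition scheme :: "'i set \<Rightarrow> ('i \<Rightarrow> bool list \<Rightarrow> cantor set) \<Rightarrow> bool" where
  "scheme I A \<longleftrightarrow> finite I \<and> (\<forall>i\<in>I. \<forall>l. clopen (A i l)) \<and>
     disjoint_family_on (\<lambda>i. A i []) I \<and> (\<Union>i\<in>I. A i []) = UNIV \<and>
     (\<forall>i\<in>I. \<forall>l. A i (True # l) \<union> A i (False # l) = A i l \<and> A i (True # l) \<inter> A i (False # l) = {}) \<and>
     separating I A"

lemma schemeD:
  assumes "scheme I A"
  shows "finite I" "i \<in> I \<Longrightarrow> clopen (A i l)" "disjoint_family_on (\<lambda>i. A i []) I" "(\<Union>i\<in>I. A i []) = UNIV"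
    "i \<in> I \<Longrightarrow> A i (True # l) \<union> A i (False # l) = A i l"
    "i \<in> I \<Longrightarrow> A i (True # l) \<inter> A i (False # l) = {}"
    "separating I A"
  using assms by (simp_all add: scheme_def)

lemma scheme_Cons_subset: "scheme I A \<Longrightarrow> i \<in> I \<Longrightarrow> A i (b # l) \<subseteq> A i l"
  by (cases b) (use schemeD(5)[of I A i l] in auto)

text \<open>By induction on the depth: a common point lies in both parents, which therefore
  coincide, and the two children of a node are disjoint.\<close>

lemma scheme_same_level:
  assumes "scheme I A" "i \<in> I" "j \<in> I" "t \<in> A i l" "t \<in> A j m" "length l = length m"
  shows "i = j \<and> l = m"
  using assms(4-6)
proof (induction l arbitrary: m)
  case Nil
  then show ?case
    using schemeD(3)[OF assms(1)] assms(2,3) by (auto simp: disjoint_family_on_def)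
next
  case (Cons b l)
  then obtain c m' where m: "m = c # m'" by (cases m) auto
  have "t \<in> A i l" "t \<in> A j m'"
    using Cons.prems m scheme_Cons_subset[OF assms(1,2), of b l] scheme_Cons_subset[OF assms(1,3), of c m']
    by auto
  then have *: "i = j" "l = m'"
    using Cons.IH[of m'] Cons.prems(3) m by auto
  then have "b = c"
    using schemeD(6)[OF assms(1,2), of l] Cons.prems m by (cases b; cases c) auto
  then show ?case using * m by simp
qed

text \<open>Descend from the root containing \<open>t\<close>, always to the child containing
  \<open>t\<close>, which exists because the children cover the node.\<close>

lemma scheme_branch:
  assumes "scheme I A"
  shows "\<exists>i\<in>I. \<exists>l. \<forall>n. t \<in> A i (l n) \<and> length (l n) = n \<and> (\<exists>b. l (Suc n) = b # l n)"
proof -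
  obtain i where i: "i \<in> I" "t \<in> A i []"
    using schemeD(4)[OF assms] by blast
  define l where "l = rec_nat [] (\<lambda>_ l. (t \<in> A i (True # l)) # l)"
  have l: "l 0 = []" "\<And>n. l (Suc n) = (t \<in> A i (True # l n)) # l n"
    by (simp_all add: l_def)
  have "t \<in> A i (l n) \<and> length (l n) = n" for n
  proof (induction n)
    case (Suc n)
    then show ?case
      using schemeD(5)[OF assms i(1), of "l n"] by (cases "t \<in> A i (True # l n)") (auto simp: l(2))
  qed (simp add: l i)
  then show ?thesis
    using i(1) l(2) by blast
qed

lemma scheme_level_cover: "scheme I A \<Longrightarrow> \<exists>i\<in>I. \<exists>l. length l = n \<and> t \<in> A i l"
  using scheme_branch[of I A t] by blast

text \<open>The graph of the homeomorphism to be built: \<open>t\<close> and \<open>s\<close> follow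
  the same branch. Exchanging the schemes gives the graph of the inverse, so each fact about one
  direction serves for both.\<close>

definition scheme_rel :: "'i set \<Rightarrow> ('i \<Rightarrow> bool list \<Rightarrow> cantor set) \<Rightarrow> ('i \<Rightarrow> bool list \<Rightarrow> cantor set)
    \<Rightarrow> cantor \<Rightarrow> cantor \<Rightarrow> bool" where
  "scheme_rel I A B t s \<longleftrightarrow> (\<forall>i\<in>I. \<forall>l. t \<in> A i l \<longleftrightarrow> s \<in> B i l)"

lemma scheme_rel_sym: "scheme_rel I A B t s \<longleftrightarrow> scheme_rel I B A s t"
  by (auto simp: scheme_rel_def)

text \<open>Along the branch of \<open>t\<close> the nodes of \<open>B\<close> are nonempty, closed
  and decreasing, so by compactness they have a common point.\<close>

lemma scheme_rel_ex:
  assumes A: "scheme I A" and B: "scheme I B"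
    and ne: "\<And>i l. i \<in> I \<Longrightarrow> A i l \<noteq> {} \<Longrightarrow> B i l \<noteq> {}"
  shows "\<exists>s. scheme_rel I A B t s"
proof -
  obtain i l where i: "i \<in> I" and l: "\<And>n. t \<in> A i (l n)" "\<And>n. length (l n) = n"
    "\<And>n. \<exists>b. l (Suc n) = b # l n"
    using scheme_branch[OF A, of t] by blast
  have dec: "B i (l n) \<subseteq> B i (l m)" if "m \<le> n" for m n
    using that
  proof (induction rule: dec_induct)
    case (step n)
    then show ?case
      using l(3)[of n] scheme_Cons_subset[OF B i] by (metis order_trans)
  qed simp
  have "UNIV \<inter> (\<Inter>n\<in>UNIV. B i (l n)) \<noteq> {}"
  proof (rule compact_imp_fip_image[OF compact_UNIV_cantor])
    show "closed (B i (l n))" for n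
      using schemeD(2)[OF B i] by (simp add: clopen_def)
    show "UNIV \<inter> (\<Inter>n\<in>J. B i (l n)) \<noteq> {}" if J: "finite J" for J
    proof -
      \<comment> \<open>The finite intersection contains the deepest node involved; \<open>0\<close>
        is inserted to make the maximum exist when \<open>J\<close> is empty.\<close>
      have "B i (l (Max (insert 0 J))) \<noteq> {}"
        using ne[OF i] l(1) by blast
      moreover have "B i (l (Max (insert 0 J))) \<subseteq> B i (l n)" if "n \<in> J" for n
        using J that by (intro dec Max_ge) auto
      ultimately show ?thesis by blast
    qed
  qed
  then obtain s where s: "\<And>n. s \<in> B i (l n)" by blast
  have "t \<in> A j m \<longleftrightarrow> s \<in> B j m" if "j \<in> I" for j m
  proof -
    \<comment> \<open>A point lies in exactly one node of each level, so membership in a node is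
      decided by comparing that node with the branch.\<close>
    have "t \<in> A j m \<longleftrightarrow> i = j \<and> l (length m) = m"
      using scheme_same_level[OF A i that l(1)[of "length m"], of m] l(1)[of "length m"] l(2) by auto
    moreover have "s \<in> B j m \<longleftrightarrow> i = j \<and> l (length m) = m"
      using scheme_same_level[OF B i that s[of "length m"], of m] s[of "length m"] l(2) by auto
    ultimately show ?thesis by simp
  qed
  then show ?thesis unfolding scheme_rel_def by blast
qed

lemma scheme_rel_unique:
  assumes B: "scheme I B" and "scheme_rel I A B t s" "scheme_rel I A B t s'"
  shows "s = s'"
proof
  fix k
  obtain N where N: "\<forall>i\<in>I. \<forall>l. N \<le> length l \<longrightarrow> (\<forall>s\<in>B i l. \<forall>t\<in>B i l. s k = t k)"
    by (rule exE[OF spec[OF schemeD(7)[OF B, unfolded separating_def], of k]])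
  obtain i l where "i \<in> I" "length l = N" "s \<in> B i l"
    using scheme_level_cover[OF B] by blast
  moreover from this have "s' \<in> B i l"
    using assms(2,3) by (auto simp: scheme_rel_def)
  ultimately show "s k = s' k" using N order_refl by metis
qed

text \<open>The set depends on finitely many coordinates, and all nodes of a sufficiently deep level
  are constant in each of them.\<close>

lemma scheme_separates:
  assumes A: "scheme I A" and "clopen C"
  shows "\<exists>N. \<forall>i\<in>I. \<forall>l. length l = N \<longrightarrow> A i l \<subseteq> C \<or> A i l \<inter> C = {}"
proof -
  obtain M where M: "determined M C"
    using clopen_imp_determined[OF assms(2)] by blast
  have "\<forall>k. \<exists>N. \<forall>i\<in>I. \<forall>l. N \<le> length l \<longrightarrow> (\<forall>s\<in>A i l. \<forall>t\<in>A i l. s k = t k)"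
    using schemeD(7)[OF A] unfolding separating_def .
  then obtain N where N: "\<And>k i l s t. i \<in> I \<Longrightarrow> N k \<le> length l \<Longrightarrow> s \<in> A i l \<Longrightarrow> t \<in> A i l \<Longrightarrow> s k = t k"
    by metis
  \<comment> \<open>For \<open>M = 0\<close> this maximum is an unspecified number. That is
    harmless, as no coordinate then has to agree.\<close>
  have "A i l \<subseteq> C \<or> A i l \<inter> C = {}" if i: "i \<in> I" and l: "length l = Max (N ` {..<M})" for i l
  proof -
    have "s \<in> C \<longleftrightarrow> t \<in> C" if "s \<in> A i l" "t \<in> A i l" for s t
      using l N[OF i _ that] by (intro determinedD[OF M]) simp
    then show ?thesis by blast
  qed
  then show ?thesis by blast
qed

lemma scheme_levels_in:
  assumes A: "scheme I A"
    and sep: "\<forall>i\<in>I. \<forall>l. length l = N \<longrightarrow> A i l \<subseteq> C \<or> A i l \<inter> C = {}"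
  shows "C = (\<Union>(i, l)\<in>{(i, l). i \<in> I \<and> length l = N \<and> A i l \<subseteq> C}. A i l)"
proof -
  have "t \<in> (\<Union>(i, l)\<in>{(i, l). i \<in> I \<and> length l = N \<and> A i l \<subseteq> C}. A i l)" if t: "t \<in> C" for t
  proof -
    obtain i l where il: "i \<in> I" "length l = N" "t \<in> A i l"
      using scheme_level_cover[OF A] by blast
    then have "A i l \<subseteq> C" using sep t by blast
    then show ?thesis using il by blast
  qed
  then show ?thesis by blast
qed

lemma finite_scheme_level: "finite I \<Longrightarrow> finite {(i, l :: bool list). i \<in> I \<and> length l = N \<and> P i l}"
  by (rule finite_subset[of _ "I \<times> {l. length l = N}"])
    (use finite_lists_length_eq[of "UNIV :: bool set" N] in auto)

lemma scheme_disjoint_level: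
  "scheme I A \<Longrightarrow> disjoint_family_on (\<lambda>(i, l). A i l) {(i, l). i \<in> I \<and> length l = N \<and> P i l}"
  using scheme_same_level by (fastforce simp: disjoint_family_on_def)

text \<open>Matching emptiness lets every branch be followed in the other scheme, in both
  directions. Continuity holds because the preimage of a coordinate set is a finite union of nodes
  of one level.\<close>

lemma scheme_iso:
  assumes A: "scheme I A" and B: "scheme I B"
    and ne: "\<And>i l. i \<in> I \<Longrightarrow> A i l = {} \<longleftrightarrow> B i l = {}"
  obtains f g where "\<And>t. g (f t) = t" "\<And>s. f (g s) = s" "continuous_on UNIV f" "continuous_on UNIV g"
    "\<And>i l. i \<in> I \<Longrightarrow> f -` B i l = A i l"
proof -
  have cont: "continuous_on UNIV f"
    if A: "scheme I A" and B: "scheme I B" and f: "\<And>t. scheme_rel I A B t (f t)" for A B f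
  proof (rule continuous_on_UNIV_cantorI)
    fix k
    let ?C = "{s :: cantor. s k}"
    obtain N where N: "\<forall>i\<in>I. \<forall>l. length l = N \<longrightarrow> B i l \<subseteq> ?C \<or> B i l \<inter> ?C = {}"
      using scheme_separates[OF B clopen_coordinate] by blast
    have "{t. f t k} = f -` ?C" by simp
    also have "\<dots> = f -` (\<Union>(i, l)\<in>{(i, l). i \<in> I \<and> length l = N \<and> B i l \<subseteq> ?C}. B i l)"
      using scheme_levels_in[OF B N] by simp
    also have "\<dots> = (\<Union>(i, l)\<in>{(i, l). i \<in> I \<and> length l = N \<and> B i l \<subseteq> ?C}. A i l)"
      using f unfolding scheme_rel_def by blast
    also have "clopen \<dots>"
      using A finite_scheme_level schemeD(1,2)[OF A] by (intro clopen_UN) auto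
    finally show "clopen {t. f t k}" .
  qed
  have "\<forall>t. \<exists>s. scheme_rel I A B t s" "\<forall>s. \<exists>t. scheme_rel I B A s t"
    using scheme_rel_ex[OF A B] scheme_rel_ex[OF B A] ne by blast+
  then obtain f g where f: "\<And>t. scheme_rel I A B t (f t)" and g: "\<And>s. scheme_rel I B A s (g s)"
    by metis
  show thesis
  proof (rule that[of g f])
    show "g (f t) = t" for t
      using scheme_rel_unique[OF A g[of "f t"]] f scheme_rel_sym by blast
    show "f (g s) = s" for s
      using scheme_rel_unique[OF B f[of "g s"]] g scheme_rel_sym by blast
    show "continuous_on UNIV f" "continuous_on UNIV g"
      using cont[OF A B f] cont[OF B A g] by auto
    show "f -` B i l = A i l" if "i \<in> I" for i l
      using f that unfolding scheme_rel_def by blast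
  qed
qed

section \<open>Measure-preserving homeomorphisms\<close>

lemma ball_subset: "A \<subseteq> B \<Longrightarrow> \<forall>x\<in>B. P x \<Longrightarrow> \<forall>x\<in>A. P x"
  by blast

locale good_cantor_measure =
  fixes \<mu> :: "cantor measure"
  assumes good: "good_measure \<mu>"
begin

lemma sets_eq: "sets \<mu> = sets borel"
  using good by (auto simp: good_measure_def full_measure_def borel_prob_measure_def)

sublocale prob_space \<mu>
  using good by (auto simp: good_measure_def full_measure_def borel_prob_measure_def)

lemma space_eq: "space \<mu> = UNIV"
  using sets_eq_imp_space_eq[OF sets_eq] by simp

lemma clopen_in_sets: "clopen U \<Longrightarrow> U \<in> sets \<mu>"
  by (simp add: sets_eq clopen_def)

lemma measure_clopen_eq_0: "clopen U \<Longrightarrow> measure \<mu> U = 0 \<longleftrightarrow> U = {}"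
  using good by (auto simp: good_measure_def full_measure_def clopen_def)

lemma measure_clopen_Diff:
  "clopen U \<Longrightarrow> clopen W \<Longrightarrow> W \<subseteq> U \<Longrightarrow> measure \<mu> (U - W) = measure \<mu> U - measure \<mu> W"
  using finite_measure_Diff clopen_in_sets by blast

lemma measure_clopen_UN:
  assumes "finite I" "\<And>i. i \<in> I \<Longrightarrow> clopen (U i)" "disjoint_family_on U I"
  shows "measure \<mu> (\<Union>i\<in>I. U i) = (\<Sum>i\<in>I. measure \<mu> (U i))"
  using assms clopen_in_sets by (intro finite_measure_finite_Union) auto

text \<open>Goodness covers strictly smaller measure; in the case of equality \<open>W\<close>
  itself serves.\<close>

lemma clopen_subset_of_measure:
  assumes "clopen U" "clopen W" "measure \<mu> U \<le> measure \<mu> W"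
  obtains W' where "clopen W'" "W' \<subseteq> W" "measure \<mu> W' = measure \<mu> U"
proof (cases "measure \<mu> U = measure \<mu> W")
  case True
  then show ?thesis using assms(2) that[of W] by simp
next
  case False
  then have "measure \<mu> U < measure \<mu> W" using assms(3) by simp
  then show ?thesis using good assms(1,2) that unfolding good_measure_def by blast
qed

text \<open>Cut off one value after another. The values are nonnegative and those remaining sum to
  the measure of what is left, so none exceeds it and goodness applies again.\<close>

lemma split_clopen:
  assumes "finite I" "clopen W" "\<And>i. i \<in> I \<Longrightarrow> v i \<in> clopen_values \<mu>" "(\<Sum>i\<in>I. v i) = measure \<mu> W"
  shows "\<exists>U. (\<forall>i\<in>I. clopen (U i) \<and> measure \<mu> (U i) = v i) \<and> disjoint_family_on U I \<and> (\<Union>i\<in>I. U i) = W"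
  using assms
proof (induction arbitrary: W rule: finite_induct)
  case empty
  \<comment> \<open>With no values left, \<open>W\<close> has measure 0 and is empty by
    fullness.\<close>
  then show ?case using measure_clopen_eq_0 by (auto simp: disjoint_family_on_def)
next
  case (insert i I)
  obtain U0 where U0: "clopen U0" "measure \<mu> U0 = v i"
    using insert.prems(2)[of i] by (auto simp: clopen_values_def)
  have nonneg: "0 \<le> v j" if "j \<in> I" for j
    using insert.prems(2)[of j] that by (auto simp: clopen_values_def)
  have "v i \<le> measure \<mu> W"
    using insert.prems(3) insert.hyps sum_nonneg[of I v] nonneg by simp
  then obtain W' where W': "clopen W'" "W' \<subseteq> W" "measure \<mu> W' = v i"
    using clopen_subset_of_measure[OF U0(1) insert.prems(1)] U0(2) by metis
  have "clopen (W - W')" "(\<Sum>j\<in>I. v j) = measure \<mu> (W - W')"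
    using W' insert.prems insert.hyps by (simp_all add: clopen_Diff measure_clopen_Diff)
  then have "\<exists>U. (\<forall>i\<in>I. clopen (U i) \<and> measure \<mu> (U i) = v i) \<and> disjoint_family_on U I \<and> (\<Union>i\<in>I. U i) = W - W'"
    using insert.prems(2) by (intro insert.IH) auto
  then obtain U where U: "\<And>j. j \<in> I \<Longrightarrow> clopen (U j)" "\<And>j. j \<in> I \<Longrightarrow> measure \<mu> (U j) = v j"
      "disjoint_family_on U I" "(\<Union>j\<in>I. U j) = W - W'"
    by auto
  have off: "(U(i := W')) j = U j" if "j \<in> I" for j
    using that insert.hyps by auto
  have "\<forall>j\<in>insert i I. clopen ((U(i := W')) j) \<and> measure \<mu> ((U(i := W')) j) = v j"
    using U(1,2) W' off by auto
  moreover have "disjoint_family_on (U(i := W')) (insert i I)"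
  proof -
    have "disjoint_family_on (U(i := W')) I"
      using U(3) off by (simp add: disjoint_family_on_def)
    moreover have "(\<Union>j\<in>I. (U(i := W')) j) = W - W'"
      using U(4) off by simp
    ultimately show ?thesis
      using insert.hyps by (subst disjoint_family_on_insert) auto
  qed
  moreover have "(\<Union>j\<in>insert i I. (U(i := W')) j) = W"
  proof -
    have "(\<Union>j\<in>I. (U(i := W')) j) = W - W'"
      using U(4) off by simp
    then show ?thesis
      using W'(2) unfolding UN_insert by auto
  qed
  ultimately show ?case by blast
qed

text \<open>Clopen sets form an intersection-stable generator of the Borel sets and the measure is
  finite, so testing on them suffices.\<close>

lemma homeoI:
  assumes "continuous_on UNIV f" "continuous_on UNIV g" "\<And>t. g (f t) = t" "\<And>s. f (g s) = s"
    and "\<And>C. clopen C \<Longrightarrow> measure \<mu> (f -` C) = measure \<mu> C"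
  shows "f \<in> homeo \<mu>"
proof -
  have f: "f \<in> measurable \<mu> \<mu>"
    unfolding measurable_cong_sets[OF sets_eq sets_eq] by (rule borel_measurable_continuous_onI) fact
  have "distr \<mu> \<mu> f = \<mu>"
  proof (rule measure_eqI_generator_eq[where E = "{U. clopen U}" and \<Omega> = UNIV and A = "\<lambda>_. UNIV"])
    show "Int_stable {U :: cantor set. clopen U}"
      by (auto simp: Int_stable_def intro: clopen_Int)
    show "emeasure (distr \<mu> \<mu> f) C = emeasure \<mu> C" if "C \<in> {U. clopen U}" for C
      using that assms(5)[of C] clopen_in_sets[of C] f
      by (simp add: emeasure_distr space_eq emeasure_eq_measure)
    show "sets (distr \<mu> \<mu> f) = sigma_sets UNIV {U. clopen U}" "sets \<mu> = sigma_sets UNIV {U. clopen U}"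
      by (simp_all add: sets_eq sets_borel_cantor)
    show "emeasure (distr \<mu> \<mu> f) UNIV \<noteq> \<infinity>"
      using f clopen_in_sets[OF clopen_UNIV] by (simp add: emeasure_distr space_eq)
  qed auto
  moreover have "homeomorphic_map euclidean euclidean f"
    using assms(1-4) by (auto simp: homeomorphic_map_maps homeomorphic_maps_def)
  ultimately show ?thesis by (simp add: homeo_def)
qed

lemma homeo_continuous: "f \<in> homeo \<mu> \<Longrightarrow> continuous_on UNIV f"
  using homeomorphic_imp_continuous_map[of euclidean euclidean f] by (simp add: homeo_def)

lemma homeo_bij: "f \<in> homeo \<mu> \<Longrightarrow> bij f"
  using homeomorphic_imp_injective_map[of euclidean euclidean f]
    homeomorphic_imp_surjective_map[of euclidean euclidean f] by (simp add: homeo_def bij_def)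

lemma homeo_measure:
  assumes "f \<in> homeo \<mu>" "clopen C"
  shows "measure \<mu> (f -` C) = measure \<mu> C"
proof -
  have "measure \<mu> C = measure (distr \<mu> \<mu> f) C"
    using assms(1) by (simp add: homeo_def)
  also have "\<dots> = measure \<mu> (f -` C)"
    using homeo_measurable[OF sets_eq assms(1)] clopen_in_sets[OF assms(2)]
    by (simp add: measure_distr space_eq)
  finally show ?thesis by simp
qed

lemma homeo_clopen_vimage: "f \<in> homeo \<mu> \<Longrightarrow> clopen C \<Longrightarrow> clopen (f -` C)"
  by (rule clopen_vimage[OF homeo_continuous])

lemma homeo_comp:
  assumes "f \<in> homeo \<mu>" "g \<in> homeo \<mu>"
  shows "f \<circ> g \<in> homeo \<mu>"
  using monoid.m_closed[OF group.is_monoid[OF group_homeo_group[OF sets_eq]]] assms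
  by (simp add: homeo_group_def)

lemma homeo_inv:
  assumes "f \<in> homeo \<mu>"
  shows "inv_into UNIV f \<in> homeo \<mu>" and homeo_group_inv: "inv\<^bsub>homeo_group \<mu>\<^esub> f = inv_into UNIV f"
proof -
  interpret G: group "homeo_group \<mu>" by (rule group_homeo_group[OF sets_eq])
  have f: "f \<in> carrier (homeo_group \<mu>)" using assms by (simp add: homeo_group_def)
  have "f \<circ> inv\<^bsub>homeo_group \<mu>\<^esub> f = id" "inv\<^bsub>homeo_group \<mu>\<^esub> f \<circ> f = id"
    using G.r_inv[OF f] G.l_inv[OF f] by (simp_all add: homeo_group_def)
  then show *: "inv\<^bsub>homeo_group \<mu>\<^esub> f = inv_into UNIV f"
    by (metis inv_unique_comp)
  show "inv_into UNIV f \<in> homeo \<mu>"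
    using G.inv_closed[OF f] unfolding * by (simp add: homeo_group_def)
qed

lemma homeo_inv_apply [simp]:
  assumes "f \<in> homeo \<mu>"
  shows "inv_into UNIV f (f t) = t" "f (inv_into UNIV f t) = t"
  using homeo_bij[OF assms] by (simp_all add: bij_is_inj bij_is_surj surj_f_inv_f)

lemma homeo_clopen_image:
  assumes "f \<in> homeo \<mu>" "clopen C"
  shows "clopen (f ` C)" "measure \<mu> (f ` C) = measure \<mu> C"
proof -
  have "f ` C = inv_into UNIV f -` C"
    by (metis assms(1) bij_vimage_eq_inv_image homeo_bij homeo_inv(1) inv_inv_eq)
  then show "clopen (f ` C)" "measure \<mu> (f ` C) = measure \<mu> C"
    using homeo_clopen_vimage[OF homeo_inv(1)[OF assms(1)] assms(2)]
      homeo_measure[OF homeo_inv(1)[OF assms(1)] assms(2)] by simp_all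
qed

section \<open>Back-and-forth between clopen sets of equal measure\<close>

definition matching_part :: "cantor set \<Rightarrow> cantor set \<Rightarrow> cantor set" where
  "matching_part U W = (SOME W'. clopen W' \<and> W' \<subseteq> W \<and> measure \<mu> W' = measure \<mu> U)"

text \<open>Goodness gives bare existence; the chosen function of \<open>U\<close> and
  \<open>W\<close> allows \<open>back_forth\<close> to be a primitive recursion.\<close>

lemma matching_part:
  assumes "clopen U" "clopen W" "measure \<mu> U \<le> measure \<mu> W"
  shows "clopen (matching_part U W)" "matching_part U W \<subseteq> W" "measure \<mu> (matching_part U W) = measure \<mu> U"
proof -
  have "\<exists>W'. clopen W' \<and> W' \<subseteq> W \<and> measure \<mu> W' = measure \<mu> U"
    using clopen_subset_of_measure[OF assms] by blast
  from someI_ex[OF this] show "clopen (matching_part U W)" "matching_part U W \<subseteq> W"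
    "measure \<mu> (matching_part U W) = measure \<mu> U"
    unfolding matching_part_def by blast+
qed

text \<open>Back and forth: even levels split the first component along a coordinate and choose a matching
  part of the second component; odd levels exchange the roles.\<close>

primrec back_forth :: "cantor set \<times> cantor set \<Rightarrow> bool list \<Rightarrow> cantor set \<times> cantor set" where
  "back_forth UW [] = UW"
| "back_forth UW (b # l) =
    (let (U, W) = back_forth UW l; C = {t. t (length l div 2)};
         (U', W') = (if even (length l) then (U \<inter> C, matching_part (U \<inter> C) W)
                     else (matching_part (W \<inter> C) U, W \<inter> C))
     in if b then (U', W') else (U - U', W - W'))"

definition balanced :: "cantor set \<times> cantor set \<Rightarrow> bool" where
  "balanced UW \<longleftrightarrow> clopen (fst UW) \<and> clopen (snd UW) \<and> measure \<mu> (fst UW) = measure \<mu> (snd UW)"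

text \<open>A normal form that hides the alternation. Later arguments about children use only this
  balanced pair \<open>(U', W')\<close> and its complement, and the parity only to know which side
  was cut along a coordinate.\<close>

lemma back_forth_step:
  assumes "balanced (back_forth UW l)"
  obtains U' W' where "balanced (U', W')" "U' \<subseteq> fst (back_forth UW l)" "W' \<subseteq> snd (back_forth UW l)"
    "\<And>b. back_forth UW (b # l) =
      (if b then (U', W') else (fst (back_forth UW l) - U', snd (back_forth UW l) - W'))"
    "even (length l) \<Longrightarrow> U' = fst (back_forth UW l) \<inter> {t. t (length l div 2)}"
    "odd (length l) \<Longrightarrow> W' = snd (back_forth UW l) \<inter> {t. t (length l div 2)}"
proof -
  obtain U W where UW: "back_forth UW l = (U, W)" by (cases "back_forth UW l")
  define C where "C = {t :: cantor. t (length l div 2)}"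
  have c: "clopen U" "clopen W" "measure \<mu> U = measure \<mu> W" "clopen (U \<inter> C)" "clopen (W \<inter> C)"
    using assms UW clopen_coordinate by (auto simp: balanced_def C_def intro!: clopen_Int)
  have le: "measure \<mu> (U \<inter> C) \<le> measure \<mu> W" "measure \<mu> (W \<inter> C) \<le> measure \<mu> U"
    using c finite_measure_mono[of "U \<inter> C" U] finite_measure_mono[of "W \<inter> C" W]
    by (auto simp: clopen_in_sets)
  show thesis
  proof (cases "even (length l)")
    case True
    show ?thesis
      using matching_part[OF c(4,2) le(1)] c True UW
      by (intro that[of "U \<inter> C" "matching_part (U \<inter> C) W"]) (auto simp: balanced_def C_def Let_def)
  next
    case False
    show ?thesis
      using matching_part[OF c(5,1) le(2)] c False UW
      by (intro that[of "matching_part (W \<inter> C) U" "W \<inter> C"]) (auto simp: balanced_def C_def Let_def)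
  qed
qed

lemma balanced_back_forth:
  assumes "balanced UW"
  shows "balanced (back_forth UW l)"
proof (induction l)
  case (Cons b l)
  from back_forth_step[OF this] obtain U' W' where *: "balanced (U', W')"
    "U' \<subseteq> fst (back_forth UW l)" "W' \<subseteq> snd (back_forth UW l)"
    "\<And>b. back_forth UW (b # l) =
      (if b then (U', W') else (fst (back_forth UW l) - U', snd (back_forth UW l) - W'))"
    by metis
  show ?case
    using * Cons unfolding *(4) by (auto simp: balanced_def clopen_Diff measure_clopen_Diff)
qed (simp add: assms)

lemma back_forth_split:
  assumes "balanced UW"
  shows "fst (back_forth UW (True # l)) \<union> fst (back_forth UW (False # l)) = fst (back_forth UW l)"
    "snd (back_forth UW (True # l)) \<union> snd (back_forth UW (False # l)) = snd (back_forth UW l)"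
    "fst (back_forth UW (True # l)) \<inter> fst (back_forth UW (False # l)) = {}"
    "snd (back_forth UW (True # l)) \<inter> snd (back_forth UW (False # l)) = {}"
proof -
  from back_forth_step[OF balanced_back_forth[OF assms]] obtain U' W' where *:
    "U' \<subseteq> fst (back_forth UW l)" "W' \<subseteq> snd (back_forth UW l)"
    "\<And>b. back_forth UW (b # l) =
      (if b then (U', W') else (fst (back_forth UW l) - U', snd (back_forth UW l) - W'))"
    by metis
  show "fst (back_forth UW (True # l)) \<union> fst (back_forth UW (False # l)) = fst (back_forth UW l)"
    "snd (back_forth UW (True # l)) \<union> snd (back_forth UW (False # l)) = snd (back_forth UW l)"
    "fst (back_forth UW (True # l)) \<inter> fst (back_forth UW (False # l)) = {}"
    "snd (back_forth UW (True # l)) \<inter> snd (back_forth UW (False # l)) = {}"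
    unfolding *(3) using *(1,2) by auto
qed

text \<open>Coordinate \<open>k\<close> cuts the first component when the path has length
  \<open>2 * k\<close> and the second when it has length \<open>2 * k + 1\<close>. After both cuts,
  at length \<open>2 * k + 2\<close>, it is constant on either side, and shrinking the nodes keeps
  it so.\<close>

lemma back_forth_coordinate:
  assumes "balanced UW" "2 * k + 2 \<le> length l"
  shows "\<exists>a. \<forall>t\<in>fst (back_forth UW l). t k = a" "\<exists>a. \<forall>t\<in>snd (back_forth UW l). t k = a"
proof -
  have "(\<exists>a. \<forall>t\<in>fst (back_forth UW l). t k = a) \<and> (\<exists>a. \<forall>t\<in>snd (back_forth UW l). t k = a)"
    if "2 * k + 2 \<le> length l"
    using that
  proof (induction l)
    case (Cons b l)
    have sub: "fst (back_forth UW (b # l)) \<subseteq> fst (back_forth UW l)"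
      "snd (back_forth UW (b # l)) \<subseteq> snd (back_forth UW l)" for b l
      using back_forth_split(1,2)[OF assms(1), of l] by (cases b; auto)+
    show ?case
    proof (cases "2 * k + 2 \<le> length l")
      case True
      then obtain x y where xy: "\<forall>t\<in>fst (back_forth UW l). t k = x" "\<forall>t\<in>snd (back_forth UW l). t k = y"
        using Cons.IH by auto
      have "\<forall>t\<in>fst (back_forth UW (b # l)). t k = x"
        using sub(1)[of b l] xy(1) by (rule ball_subset)
      moreover have "\<forall>t\<in>snd (back_forth UW (b # l)). t k = y"
        using sub(2)[of b l] xy(2) by (rule ball_subset)
      ultimately show ?thesis by (intro conjI exI)
    next
      case False
      \<comment> \<open>Exactly the critical length. The bit \<open>c\<close> was the outcome of the
        cut on the first side and \<open>b\<close> is that of the cut on the second, so these are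
        the constant values.\<close>
      then have len: "length l = 2 * k + 1" using Cons.prems by simp
      then obtain c m where l: "l = c # m" by (cases l) auto
      have m: "length m = 2 * k" using len l by simp
      have "\<forall>t\<in>fst (back_forth UW (c # m)). t k = c"
        by (rule back_forth_step[OF balanced_back_forth[OF assms(1)], of m]) (simp add: m split: if_splits)
      moreover have "\<forall>t\<in>snd (back_forth UW (b # l)). t k = b"
        by (rule back_forth_step[OF balanced_back_forth[OF assms(1)], of l]) (simp add: len split: if_splits)
      ultimately show ?thesis
        using ball_subset[OF sub(1)[of b l], of "\<lambda>t. t k = c"] l by (intro conjI exI) simp_all
    qed
  qed simp
  then show "\<exists>a. \<forall>t\<in>fst (back_forth UW l). t k = a" "\<exists>a. \<forall>t\<in>snd (back_forth UW l). t k = a"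
    using assms(2) by auto
qed

text \<open>Grow \<open>back_forth\<close> from each pair \<open>(U i, W i)\<close>. Corresponding
  nodes have equal measure, hence are empty together by fullness, and the schemes are isomorphic. A
  clopen set is a disjoint union of nodes of one level of \<open>B\<close>, whose preimages are
  nodes of \<open>A\<close> of the same measure.\<close>

lemma partition_homeo:
  assumes "finite I"
    and U: "\<And>i. i \<in> I \<Longrightarrow> clopen (U i)" "disjoint_family_on U I" "(\<Union>i\<in>I. U i) = UNIV"
    and W: "\<And>i. i \<in> I \<Longrightarrow> clopen (W i)" "disjoint_family_on W I" "(\<Union>i\<in>I. W i) = UNIV"
    and eq: "\<And>i. i \<in> I \<Longrightarrow> measure \<mu> (U i) = measure \<mu> (W i)"
  shows "\<exists>g\<in>homeo \<mu>. \<forall>i\<in>I. g -` W i = U i"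
proof -
  define A B where "A = (\<lambda>i l. fst (back_forth (U i, W i) l))" and "B = (\<lambda>i l. snd (back_forth (U i, W i) l))"
  have bal: "balanced (U i, W i)" if "i \<in> I" for i
    using that U W eq by (simp add: balanced_def)
  have cl: "clopen (A i l)" "clopen (B i l)" and me: "measure \<mu> (A i l) = measure \<mu> (B i l)" if "i \<in> I" for i l
    using balanced_back_forth[OF bal[OF that], of l] by (auto simp: balanced_def A_def B_def)
  have "separating I A" "separating I B"
    unfolding separating_def A_def B_def using back_forth_coordinate[OF bal] by meson+
  then have SA: "scheme I A" and SB: "scheme I B"
    unfolding scheme_def using assms(1) U W cl back_forth_split[OF bal]
    by (simp_all add: A_def B_def)
  have ne: "A i l = {} \<longleftrightarrow> B i l = {}" if "i \<in> I" for i l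
    using measure_clopen_eq_0[OF cl(1)[OF that, of l]] measure_clopen_eq_0[OF cl(2)[OF that, of l]]
      me[OF that, of l] by simp
  obtain f g where fg: "\<And>t. g (f t) = t" "\<And>s. f (g s) = s" "continuous_on UNIV f" "continuous_on UNIV g"
    and f: "\<And>i l. i \<in> I \<Longrightarrow> f -` B i l = A i l"
    by (rule scheme_iso[OF SA SB ne]; (assumption | (rule that; assumption)))
  have "measure \<mu> (f -` C) = measure \<mu> C" if C: "clopen C" for C
  proof -
    obtain N where N: "\<forall>i\<in>I. \<forall>l. length l = N \<longrightarrow> B i l \<subseteq> C \<or> B i l \<inter> C = {}"
      using scheme_separates[OF SB C] by blast
    define J where "J = {(i, l). i \<in> I \<and> length l = N \<and> B i l \<subseteq> C}"
    have J: "finite J" "J \<subseteq> I \<times> UNIV"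
      using finite_scheme_level[OF assms(1)] by (auto simp: J_def)
    have meas: "measure \<mu> (\<Union>(i, l)\<in>J. S i l) = (\<Sum>(i, l)\<in>J. measure \<mu> (S i l))" if S: "scheme I S" for S
    proof -
      have "disjoint_family_on (\<lambda>(i, l). S i l) J"
        unfolding J_def by (rule scheme_disjoint_level[OF S])
      moreover have "clopen (case x of (i, l) \<Rightarrow> S i l)" if "x \<in> J" for x
        using that J(2) schemeD(2)[OF S] by auto
      ultimately show ?thesis
        using measure_clopen_UN[OF J(1), of "\<lambda>(i, l). S i l"] by (simp add: split_def)
    qed
    have CB: "C = (\<Union>(i, l)\<in>J. B i l)"
      unfolding J_def by (rule scheme_levels_in[OF SB N])
    have "f -` C = (\<Union>(i, l)\<in>J. f -` B i l)"
      by (subst CB) auto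
    also have "\<dots> = (\<Union>(i, l)\<in>J. A i l)"
      using f J(2) by (intro SUP_cong refl) auto
    finally have "measure \<mu> (f -` C) = measure \<mu> (\<Union>(i, l)\<in>J. A i l)"
      by simp
    also have "\<dots> = (\<Sum>(i, l)\<in>J. measure \<mu> (A i l))"
      by (rule meas[OF SA])
    also have "\<dots> = (\<Sum>(i, l)\<in>J. measure \<mu> (B i l))"
      using me J(2) by (intro sum.cong) auto
    also have "\<dots> = measure \<mu> C"
      using meas[OF SB] CB by simp
    finally show ?thesis .
  qed
  then have "f \<in> homeo \<mu>"
    using homeoI[OF fg(3,4,1,2)] by blast
  moreover have "f -` W i = U i" if "i \<in> I" for i
    using f[OF that, of "[]"] by (simp add: A_def B_def)
  ultimately show ?thesis by blast
qed

end

section \<open>Matrices of homeomorphisms\<close>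

lemma clopen_partitionD:
  assumes "clopen_partition P"
  shows "finite P" "p \<in> P \<Longrightarrow> clopen p" "p \<in> P \<Longrightarrow> p \<noteq> {}" "disjoint_family_on (\<lambda>p. p) P" "\<Union>P = UNIV"
    "p \<in> P \<Longrightarrow> p' \<in> P \<Longrightarrow> t \<in> p \<Longrightarrow> t \<in> p' \<Longrightarrow> p = p'"
  using assms unfolding clopen_partition_def partition_on_def disjoint_def disjoint_family_on_def
  by auto

lemma clopen_partition_cover:
  assumes "clopen_partition P"
  obtains p where "p \<in> P" "t \<in> p"
proof -
  have "t \<in> \<Union>P" using clopen_partitionD(5)[OF assms] by simp
  then show thesis using that by (rule UnionE)
qed

lemma disjoint_family_on_pointI:
  "(\<And>i j t. i \<in> I \<Longrightarrow> j \<in> I \<Longrightarrow> t \<in> A i \<Longrightarrow> t \<in> A j \<Longrightarrow> i = j) \<Longrightarrow> disjoint_family_on A I"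
  unfolding disjoint_family_on_def by blast

text \<open>All the sets depend on the first \<open>N\<close> coordinates for a common
  \<open>N\<close>; the cylinders of length \<open>N\<close> do the job.\<close>

lemma clopen_partition_refining:
  assumes "finite \<U>" "\<And>U. U \<in> \<U> \<Longrightarrow> clopen U"
  obtains P where "clopen_partition P" "\<And>U p. U \<in> \<U> \<Longrightarrow> p \<in> P \<Longrightarrow> p \<subseteq> U \<or> p \<inter> U = {}"
proof -
  obtain N where N: "\<forall>U\<in>\<U>. determined N U"
    using clopens_determined[OF assms] by blast
  have "range (cylinder N) = cylinder N ` range (restrict_bits N)"
  proof -
    have "cylinder N x = cylinder N (restrict_bits N x)" for x
      by (auto simp: cylinder_def restrict_bits_def)
    then show ?thesis by blast
  qed
  then have "finite (range (cylinder N))"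
    by (simp add: finite_range_restrict_bits)
  moreover have "partition_on UNIV (range (cylinder N))"
  proof (rule partition_onI)
    show "\<Union> (range (cylinder N)) = UNIV" by (auto simp: cylinder_def)
    show "disjnt p q" if "p \<in> range (cylinder N)" "q \<in> range (cylinder N)" "p \<noteq> q" for p q
      using that by (auto simp: cylinder_def disjnt_def)
    show "{} \<notin> range (cylinder N)" by (auto simp: cylinder_def)
  qed
  ultimately have "clopen_partition (range (cylinder N))"
    by (auto simp: clopen_partition_def clopen_cylinder)
  moreover have "p \<subseteq> U \<or> p \<inter> U = {}" if U: "U \<in> \<U>" and p: "p \<in> range (cylinder N)" for U p
  proof -
    have "s \<in> U \<longleftrightarrow> t \<in> U" if "s \<in> p" "t \<in> p" for s t
      using that p N U by (intro determinedD[of N U]) (auto simp: cylinder_def)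
    then show ?thesis by blast
  qed
  ultimately show thesis by (rule that)
qed

lemma Union_partition_subset:
  assumes "clopen_partition P" "\<And>p. p \<in> P \<Longrightarrow> p \<subseteq> U \<or> p \<inter> U = {}"
  shows "\<Union>{p\<in>P. p \<subseteq> U} = U"
proof -
  have "t \<in> \<Union>{p\<in>P. p \<subseteq> U}" if "t \<in> U" for t
  proof -
    obtain p where "p \<in> P" "t \<in> p"
      using clopen_partition_cover[OF assms(1)] .
    moreover from this have "p \<subseteq> U"
      using assms(2)[of p] that by auto
    ultimately show ?thesis by blast
  qed
  then show ?thesis by auto
qed

lemma vimage_eq_of_partition:
  assumes "clopen_partition P" "\<And>p. p \<in> P \<Longrightarrow> p \<subseteq> U \<or> p \<inter> U = {}" "\<And>p. p \<in> P \<Longrightarrow> f -` p = h -` p"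
  shows "f -` U = h -` U"
proof -
  have "f -` (\<Union>{p\<in>P. p \<subseteq> U}) = h -` (\<Union>{p\<in>P. p \<subseteq> U})"
    using assms(3) unfolding vimage_Union by auto
  then show ?thesis
    using Union_partition_subset[OF assms(1,2)] by simp
qed

text \<open>Preimages of the parts of a partition are disjoint and cover, which leaves no room for a
  strict inclusion. This matters because the compact-open topology controls inclusions only.\<close>

lemma vimage_eq_of_vimage_subset:
  assumes "clopen_partition P" "\<And>p. p \<in> P \<Longrightarrow> f -` p \<subseteq> h -` p" "p \<in> P"
  shows "h -` p = f -` p"
proof -
  have "f t \<in> p" if "h t \<in> p" for t
  proof -
    obtain p' where p': "p' \<in> P" "f t \<in> p'"
      using clopen_partition_cover[OF assms(1)] .
    then have "h t \<in> p'" using assms(2)[OF p'(1)] by auto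
    then have "p' = p" using clopen_partitionD(6)[OF assms(1) p'(1) assms(3)] that by simp
    then show ?thesis using p' by simp
  qed
  then show ?thesis using assms(2)[OF assms(3)] by auto
qed

definition conj_map :: "('a \<Rightarrow> 'a) \<Rightarrow> ('a \<Rightarrow> 'a) \<Rightarrow> 'a \<Rightarrow> 'a" where
  "conj_map g h = g \<circ> h \<circ> inv_into UNIV g"

lemma conj_map_comp: "bij g \<Longrightarrow> bij k \<Longrightarrow> conj_map (g \<circ> k) h = conj_map g (conj_map k h)"
  by (simp add: conj_map_def o_inv_distrib o_assoc)

lemma conj_map_inv: "bij g \<Longrightarrow> conj_map (inv_into UNIV g) (conj_map g h) = h"
  by (auto simp: conj_map_def fun_eq_iff inv_inv_eq bij_is_inj)

text \<open>The entry is the mass that \<open>h\<close> carries from \<open>p\<close> into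
  \<open>p'\<close>. The restriction to pairs of parts supplies the extensionality required of
  objects.\<close>

definition matrix_of :: "cantor measure \<Rightarrow> (cantor \<Rightarrow> cantor) \<Rightarrow> cantor set set \<Rightarrow> cantor set \<times> cantor set \<Rightarrow> real" where
  "matrix_of \<mu> h P = (\<lambda>(p, p')\<in>P \<times> P. measure \<mu> (p \<inter> h -` p'))"

definition realises :: "cantor measure \<Rightarrow> (cantor \<Rightarrow> cantor) \<Rightarrow> matrix_obj \<Rightarrow> bool" where
  "realises \<mu> h A \<longleftrightarrow> (\<forall>p\<in>fst A. \<forall>p'\<in>fst A. measure \<mu> (p \<inter> h -` p') = snd A (p, p'))"

lemma matrix_objectsD:
  assumes "(P, a) \<in> matrix_objects V \<mu>"
  shows "clopen_partition P" "p \<in> P \<Longrightarrow> p' \<in> P \<Longrightarrow> a (p, p') \<in> V"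
    "p \<in> P \<Longrightarrow> (\<Sum>p'\<in>P. a (p, p')) = measure \<mu> p" "p \<in> P \<Longrightarrow> (\<Sum>p'\<in>P. a (p', p)) = measure \<mu> p"
  using assms by (auto simp: matrix_objects_def)

text \<open>An object consists of finitely many clopen sets and finitely many entries from
  \<open>V\<close>.\<close>

lemma countable_matrix_objects:
  assumes "countable V"
  shows "countable (matrix_objects V \<mu>)"
proof (rule countable_subset)
  let ?\<P> = "{P. finite P \<and> P \<subseteq> {U :: cantor set. clopen U}}"
  show "matrix_objects V \<mu> \<subseteq> (SIGMA P:?\<P>. P \<times> P \<rightarrow>\<^sub>E V)"
    by (auto simp: matrix_objects_def clopen_partition_def)
  show "countable (SIGMA P:?\<P>. P \<times> P \<rightarrow>\<^sub>E V)"
    using assms countable_Collect_finite_subset[OF countable_clopen]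
    by (intro countable_SIGMA countable_PiE) auto
qed

section \<open>Realising matrices and transporting them by conjugation\<close>

context good_cantor_measure
begin

lemma conj_map_homeo: "g \<in> homeo \<mu> \<Longrightarrow> h \<in> homeo \<mu> \<Longrightarrow> conj_map g h \<in> homeo \<mu>"
  by (simp add: conj_map_def homeo_comp homeo_inv)

lemma clopen_Int_vimage: "h \<in> homeo \<mu> \<Longrightarrow> clopen X \<Longrightarrow> clopen Y \<Longrightarrow> clopen (X \<inter> h -` Y)"
  by (simp add: clopen_Int homeo_clopen_vimage)

text \<open>Pull back by \<open>g\<close>, which preserves the measure. Conjugating by
  \<open>g\<close> thus amounts to replacing a partition by its pullback under
  \<open>g\<close>.\<close>

lemma measure_conj_map:
  assumes g: "g \<in> homeo \<mu>" and h: "h \<in> homeo \<mu>" and "clopen X" "clopen Y"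
  shows "measure \<mu> (X \<inter> conj_map g h -` Y) = measure \<mu> (g -` X \<inter> h -` (g -` Y))"
proof -
  have "g -` (X \<inter> conj_map g h -` Y) = g -` X \<inter> h -` (g -` Y)"
    using g by (auto simp: conj_map_def)
  then show ?thesis
    using homeo_measure[OF g clopen_Int_vimage[OF conj_map_homeo[OF g h] assms(3,4)]] by simp
qed

lemma measure_Union_partition:
  assumes P: "clopen_partition P" and F: "F \<subseteq> P"
  shows "measure \<mu> (\<Union>F) = (\<Sum>p\<in>F. measure \<mu> p)"
  using measure_clopen_UN[of F "\<lambda>p. p"] clopen_partitionD(1,2)[OF P] F
    disjoint_family_on_mono[OF F clopen_partitionD(4)[OF P]] finite_subset[OF F] by auto

text \<open>Additivity in each argument. With fibres of a map as \<open>F\<close> and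
  \<open>F'\<close>, the right-hand side is the double sum in the definition of a morphism.\<close>

lemma measure_Union_vimage_Union:
  assumes h: "h \<in> homeo \<mu>" and Q: "clopen_partition Q" and F: "F \<subseteq> Q" and F': "F' \<subseteq> Q"
  shows "measure \<mu> (\<Union>F \<inter> h -` (\<Union>F')) = (\<Sum>q\<in>F. \<Sum>q'\<in>F'. measure \<mu> (q \<inter> h -` q'))"
proof -
  note Q' = clopen_partitionD[OF Q]
  have fin: "finite F" "finite F'"
    using F F' Q'(1) finite_subset by auto
  have cl: "clopen (\<Union>F')"
    using clopen_UN[OF fin(2), of "\<lambda>q. q"] F' Q'(2) by auto
  have "\<Union>F \<inter> h -` (\<Union>F') = (\<Union>q\<in>F. q \<inter> h -` (\<Union>F'))" by auto
  moreover have "disjoint_family_on (\<lambda>q. q \<inter> h -` (\<Union>F')) F"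
    using Q'(4) F unfolding disjoint_family_on_def by blast
  ultimately have "measure \<mu> (\<Union>F \<inter> h -` (\<Union>F')) = (\<Sum>q\<in>F. measure \<mu> (q \<inter> h -` (\<Union>F')))"
    using F Q'(2) cl fin clopen_Int_vimage[OF h] by (simp only:) (rule measure_clopen_UN, auto)
  also have "\<dots> = (\<Sum>q\<in>F. \<Sum>q'\<in>F'. measure \<mu> (q \<inter> h -` q'))"
  proof (rule sum.cong[OF refl])
    fix q assume q: "q \<in> F"
    have c: "clopen (q \<inter> h -` q')" if "q' \<in> F'" for q'
      using q that F F' by (intro clopen_Int_vimage[OF h] Q'(2)) auto
    have "q \<inter> h -` (\<Union>F') = (\<Union>q'\<in>F'. q \<inter> h -` q')" by auto
    moreover have "disjoint_family_on (\<lambda>q'. q \<inter> h -` q') F'"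
      using Q'(4) F' unfolding disjoint_family_on_def by blast
    ultimately show "measure \<mu> (q \<inter> h -` (\<Union>F')) = (\<Sum>q'\<in>F'. measure \<mu> (q \<inter> h -` q'))"
      using fin(2) c by (simp only:) (rule measure_clopen_UN, auto)
  qed
  finally show ?thesis .
qed

text \<open>Row sums are additivity; column sums need the invariance of the measure under
  \<open>h\<close> as well.\<close>

lemma matrix_of_object:
  assumes h: "h \<in> homeo \<mu>" and P: "clopen_partition P"
  shows "(P, matrix_of \<mu> h P) \<in> matrix_objects (clopen_values \<mu>) \<mu>"
proof -
  have "(\<Sum>p'\<in>P. measure \<mu> (p \<inter> h -` p')) = measure \<mu> p"
    "(\<Sum>p'\<in>P. measure \<mu> (p' \<inter> h -` p)) = measure \<mu> p" if "p \<in> P" for p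
    using measure_Union_vimage_Union[OF h P, of "{p}" P] measure_Union_vimage_Union[OF h P, of P "{p}"]
      that clopen_partitionD(2,5)[OF P] homeo_measure[OF h] by simp_all
  moreover have "measure \<mu> (p \<inter> h -` p') \<in> clopen_values \<mu>" if "p \<in> P" "p' \<in> P" for p p'
    using clopen_Int_vimage[OF h] clopen_partitionD(2)[OF P] that unfolding clopen_values_def by blast
  ultimately show ?thesis
    using P by (auto simp: matrix_objects_def matrix_of_def)
qed

lemma realises_matrix_of: "realises \<mu> f (P, matrix_of \<mu> h P) \<longleftrightarrow>
    (\<forall>p\<in>P. \<forall>p'\<in>P. measure \<mu> (p \<inter> f -` p') = measure \<mu> (p \<inter> h -` p'))"
  by (simp add: realises_def matrix_of_def)

text \<open>By the row sums each \<open>p\<close> can be cut into parts of measures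
  \<open>a (p, p')\<close>, by the column sums each \<open>p'\<close> into parts of these same
  measures. The homeomorphism carries the part of \<open>p\<close> labelled \<open>p'\<close> onto
  the part of \<open>p'\<close> labelled \<open>p\<close>.\<close>

lemma ex_realising:
  assumes A: "(P, a) \<in> matrix_objects (clopen_values \<mu>) \<mu>"
  obtains h where "h \<in> homeo \<mu>" "realises \<mu> h (P, a)"
proof -
  note PA = matrix_objectsD[OF A]
  note P = clopen_partitionD[OF PA(1)]
  have "\<forall>p\<in>P. \<exists>U. (\<forall>p'\<in>P. clopen (U p') \<and> measure \<mu> (U p') = a (p, p')) \<and>
      disjoint_family_on U P \<and> (\<Union>p'\<in>P. U p') = p"
    using PA P by (intro ballI split_clopen) auto
  from bchoice[OF this] obtain U where U: "\<And>p p'. p \<in> P \<Longrightarrow> p' \<in> P \<Longrightarrow> clopen (U p p')"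
    "\<And>p p'. p \<in> P \<Longrightarrow> p' \<in> P \<Longrightarrow> measure \<mu> (U p p') = a (p, p')"
    "\<And>p. p \<in> P \<Longrightarrow> disjoint_family_on (U p) P" "\<And>p. p \<in> P \<Longrightarrow> (\<Union>p'\<in>P. U p p') = p"
    by metis
  have "\<forall>p'\<in>P. \<exists>W. (\<forall>p\<in>P. clopen (W p) \<and> measure \<mu> (W p) = a (p, p')) \<and>
      disjoint_family_on W P \<and> (\<Union>p\<in>P. W p) = p'"
    using PA P by (intro ballI split_clopen) auto
  from bchoice[OF this] obtain W where W: "\<And>p p'. p \<in> P \<Longrightarrow> p' \<in> P \<Longrightarrow> clopen (W p' p)"
    "\<And>p p'. p \<in> P \<Longrightarrow> p' \<in> P \<Longrightarrow> measure \<mu> (W p' p) = a (p, p')"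
    "\<And>p. p \<in> P \<Longrightarrow> disjoint_family_on (W p) P" "\<And>p. p \<in> P \<Longrightarrow> (\<Union>p'\<in>P. W p p') = p"
    by metis
  \<comment> \<open>Stated for any family \<open>X\<close>, since it serves for the row parts
    \<open>U\<close> and the column parts \<open>W\<close>.\<close>
  have inj: "p = q \<and> p' = q'"
    if X: "\<And>p. p \<in> P \<Longrightarrow> disjoint_family_on (X p) P" "\<And>p. p \<in> P \<Longrightarrow> (\<Union>p'\<in>P. X p p') = p"
      and pq: "p \<in> P" "p' \<in> P" "q \<in> P" "q' \<in> P" "t \<in> X p p'" "t \<in> X q q'" for X p p' q q' t
  proof -
    have "t \<in> p" "t \<in> q"
      using pq X(2)[of p] X(2)[of q] by blast+
    then have "p = q" using P(6) pq by simp
    then show ?thesis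
      using X(1)[of p] pq unfolding disjoint_family_on_def by blast
  qed
  have cov: "(\<Union>(p, p')\<in>P \<times> P. X p p') = UNIV"
    if X: "\<And>p. p \<in> P \<Longrightarrow> (\<Union>p'\<in>P. X p p') = p" for X
  proof -
    have "(\<Union>(p, p')\<in>P \<times> P. X p p') = (\<Union>p\<in>P. \<Union>p'\<in>P. X p p')" by auto
    also have "\<dots> = \<Union>P" using X by simp
    finally show ?thesis using P(5) by simp
  qed
  have "disjoint_family_on (\<lambda>(p, p'). U p p') (P \<times> P)"
  proof (rule disjoint_family_on_pointI)
    fix x y t
    assume "x \<in> P \<times> P" "y \<in> P \<times> P" "t \<in> (case x of (p, p') \<Rightarrow> U p p')" "t \<in> (case y of (p, p') \<Rightarrow> U p p')"
    then show "x = y"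
      using inj[OF U(3,4), of "fst x" "snd x" "fst y" "snd y" t] by (auto simp: split_def prod_eq_iff)
  qed
  moreover have "disjoint_family_on (\<lambda>(p, p'). W p' p) (P \<times> P)"
  proof (rule disjoint_family_on_pointI)
    fix x y t
    assume "x \<in> P \<times> P" "y \<in> P \<times> P" "t \<in> (case x of (p, p') \<Rightarrow> W p' p)" "t \<in> (case y of (p, p') \<Rightarrow> W p' p)"
    then show "x = y"
      using inj[OF W(3,4), of "snd x" "fst x" "snd y" "fst y" t] by (auto simp: split_def prod_eq_iff)
  qed
  moreover have "(\<Union>(p, p')\<in>P \<times> P. W p' p) = UNIV"
    using cov[of W, OF W(4)] by auto
  ultimately obtain h where h: "h \<in> homeo \<mu>" "\<forall>x\<in>P \<times> P. h -` (case x of (p, p') \<Rightarrow> W p' p) = (case x of (p, p') \<Rightarrow> U p p')"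
    using partition_homeo[of "P \<times> P" "\<lambda>(p, p'). U p p'" "\<lambda>(p, p'). W p' p"] cov[of U, OF U(4)]
      P(1) U(1,2) W(1,2) by auto
  have "p \<inter> h -` p' = U p p'" if p: "p \<in> P" "p' \<in> P" for p p'
  proof -
    have "p \<inter> h -` p' = p \<inter> (\<Union>q\<in>P. h -` (W p' q))"
      using W(4)[OF p(2)] by (metis vimage_UN)
    also have "\<dots> = p \<inter> (\<Union>q\<in>P. U q p')"
      using h(2) p(2) by auto
    \<comment> \<open>Only the term with \<open>q = p\<close> meets \<open>p\<close>, because
      \<open>U q p'\<close> lies in \<open>q\<close>.\<close>
    also have "\<dots> = U p p'"
    proof -
      have "U q p' \<subseteq> q" if "q \<in> P" for q using U(4)[OF that] p(2) by blast
      then show ?thesis using p P(6) by blast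
    qed
    finally show ?thesis .
  qed
  then have "realises \<mu> h (P, a)"
    using U(2) by (simp add: realises_def)
  then show thesis using h(1) that by blast
qed

text \<open>The measure condition on \<open>f\<close> allows each \<open>p\<close> to be cut into
  parts \<open>W q\<close> with the measures of the \<open>q\<close> above it. A homeomorphism
  \<open>g\<close> taking each \<open>q\<close> onto \<open>W q\<close> pulls \<open>p\<close> back
  to the union of its fibre, so conjugation sums \<open>b\<close> over fibres.\<close>

lemma realises_along_morphism:
  assumes P: "clopen_partition P" and Q: "clopen_partition Q"
    and f: "f \<in> matrix_morphisms \<mu> (Q, b) (P, a)"
    and h: "h \<in> homeo \<mu>" "realises \<mu> h (Q, b)"
  obtains g where "g \<in> homeo \<mu>" "realises \<mu> (conj_map g h) (P, a)"
proof -
  note P' = clopen_partitionD[OF P] and Q' = clopen_partitionD[OF Q]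
  have fQ: "f q \<in> P" if "q \<in> Q" for q
    using f that by (auto simp: matrix_morphisms_def measure_morphism_def)
  have mp: "measure \<mu> p = (\<Sum>q\<in>{q\<in>Q. f q = p}. measure \<mu> q)" if "p \<in> P" for p
    using f that by (auto simp: matrix_morphisms_def measure_morphism_def)
  have ap: "a (p, p') = (\<Sum>q\<in>{q\<in>Q. f q = p}. \<Sum>q'\<in>{q'\<in>Q. f q' = p'}. b (q, q'))" if "p \<in> P" "p' \<in> P" for p p'
    using f that by (auto simp: matrix_morphisms_def)
  have "\<forall>p\<in>P. \<exists>U. (\<forall>q\<in>{q\<in>Q. f q = p}. clopen (U q) \<and> measure \<mu> (U q) = measure \<mu> q) \<and>
      disjoint_family_on U {q\<in>Q. f q = p} \<and> (\<Union>q\<in>{q\<in>Q. f q = p}. U q) = p"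
    using mp P'(2) Q' by (intro ballI split_clopen) (auto simp: clopen_values_def)
  then obtain X where X0: "\<forall>p\<in>P. (\<forall>q\<in>{q\<in>Q. f q = p}. clopen (X p q) \<and> measure \<mu> (X p q) = measure \<mu> q) \<and>
      disjoint_family_on (X p) {q\<in>Q. f q = p} \<and> (\<Union>q\<in>{q\<in>Q. f q = p}. X p q) = p"
    by (rule bchoice[THEN exE])
  have X:
    "\<And>p q. p \<in> P \<Longrightarrow> q \<in> Q \<Longrightarrow> f q = p \<Longrightarrow> clopen (X p q) \<and> measure \<mu> (X p q) = measure \<mu> q"
    "\<And>p. p \<in> P \<Longrightarrow> disjoint_family_on (X p) {q\<in>Q. f q = p}"
    "\<And>p. p \<in> P \<Longrightarrow> (\<Union>q\<in>{q\<in>Q. f q = p}. X p q) = p"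
    using X0 by auto
  define W where "W q = X (f q) q" for q
  have sub: "W q \<subseteq> f q" if "q \<in> Q" for q
    using X(3)[OF fQ[OF that]] that unfolding W_def by blast
  have W: "(\<Union>q\<in>{q\<in>Q. f q = p}. W q) = p" if "p \<in> P" for p
    using X(3)[OF that] by (auto simp: W_def)
  have "disjoint_family_on W Q"
    unfolding disjoint_family_on_def
  proof (intro ballI impI)
    fix q q' assume q: "q \<in> Q" "q' \<in> Q" "q \<noteq> q'"
    show "W q \<inter> W q' = {}"
    proof (cases "f q = f q'")
      case True
      then show ?thesis
        using X(2)[OF fQ[OF q(1)]] q unfolding disjoint_family_on_def W_def by auto
    next
      case False
      then show ?thesis
        using sub[OF q(1)] sub[OF q(2)] P'(6)[OF fQ[OF q(1)] fQ[OF q(2)]] by blast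
    qed
  qed
  moreover have "(\<Union>q\<in>Q. W q) = UNIV"
  proof -
    have "(\<Union>p\<in>P. \<Union>q\<in>{q\<in>Q. f q = p}. W q) = UNIV"
      using W P'(5) by simp
    then show ?thesis by blast
  qed
  ultimately obtain g where g: "g \<in> homeo \<mu>" "\<forall>q\<in>Q. g -` W q = q"
    using partition_homeo[of Q "\<lambda>q. q" W] Q' X(1) fQ by (auto simp: W_def)
  have gp: "g -` p = \<Union>{q\<in>Q. f q = p}" if "p \<in> P" for p
  proof -
    have "g -` p = (\<Union>q\<in>{q\<in>Q. f q = p}. g -` W q)"
      using W[OF that] by (metis vimage_UN)
    then show ?thesis using g(2) by simp
  qed
  have "measure \<mu> (p \<inter> conj_map g h -` p') = a (p, p')" if p: "p \<in> P" "p' \<in> P" for p p'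
  proof -
    have "measure \<mu> (p \<inter> conj_map g h -` p') = measure \<mu> (g -` p \<inter> h -` (g -` p'))"
      using measure_conj_map[OF g(1) h(1)] P'(2) p by simp
    also have "\<dots> = (\<Sum>q\<in>{q\<in>Q. f q = p}. \<Sum>q'\<in>{q\<in>Q. f q = p'}. measure \<mu> (q \<inter> h -` q'))"
      unfolding gp[OF p(1)] gp[OF p(2)] by (rule measure_Union_vimage_Union[OF h(1) Q]) auto
    also have "\<dots> = a (p, p')"
      unfolding ap[OF p] using h(2) by (intro sum.cong) (auto simp: realises_def)
    finally show ?thesis .
  qed
  then show thesis
    using that[OF g(1)] by (simp add: realises_def)
qed

text \<open>Equal matrices let \<open>g\<close> carry the points of \<open>p\<close> sent to
  \<open>p'\<close> by \<open>h\<close> onto those sent there by \<open>f\<close>. Unions over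
  \<open>p'\<close> show that \<open>g\<close> fixes each part setwise; unions over \<open>p\<close>
  show that it takes preimages under \<open>h\<close> to preimages under \<open>f\<close>.\<close>

lemma conj_map_agrees_on_partition:
  assumes f: "f \<in> homeo \<mu>" and h: "h \<in> homeo \<mu>" and P: "clopen_partition P"
    and r: "realises \<mu> h (P, matrix_of \<mu> f P)"
  obtains g where "g \<in> homeo \<mu>" "\<And>p. p \<in> P \<Longrightarrow> conj_map g h -` p = f -` p"
proof -
  note P' = clopen_partitionD[OF P]
  have dis: "disjoint_family_on (\<lambda>(p, p'). p \<inter> k -` p') (P \<times> P)" for k
  proof (rule disjoint_family_on_pointI)
    fix x y t
    assume "x \<in> P \<times> P" "y \<in> P \<times> P" "t \<in> (case x of (p, p') \<Rightarrow> p \<inter> k -` p')" "t \<in> (case y of (p, p') \<Rightarrow> p \<inter> k -` p')"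
    then show "x = y"
      using P'(6)[of "fst x" "fst y" t] P'(6)[of "snd x" "snd y" "k t"] by (auto simp: split_def prod_eq_iff)
  qed
  have cov: "(\<Union>(p, p')\<in>P \<times> P. p \<inter> k -` p') = UNIV" for k
  proof -
    have "t \<in> (\<Union>(p, p')\<in>P \<times> P. p \<inter> k -` p')" for t
    proof -
      obtain p p' where "p \<in> P" "t \<in> p" "p' \<in> P" "k t \<in> p'"
        using clopen_partition_cover[OF P] by metis
      then show ?thesis by auto
    qed
    then show ?thesis by auto
  qed
  obtain g where g: "g \<in> homeo \<mu>"
    "\<forall>x\<in>P \<times> P. g -` (case x of (p, p') \<Rightarrow> p \<inter> f -` p') = (case x of (p, p') \<Rightarrow> p \<inter> h -` p')"
    using partition_homeo[of "P \<times> P" "\<lambda>(p, p'). p \<inter> h -` p'" "\<lambda>(p, p'). p \<inter> f -` p'"]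
      dis cov P'(1,2) clopen_Int_vimage[OF f] clopen_Int_vimage[OF h] r by (auto simp: realises_matrix_of)
  have g2: "g -` p \<inter> g -` f -` p' = p \<inter> h -` p'" if "p \<in> P" "p' \<in> P" for p p'
    using g(2) that by auto
  have cover: "(\<Union>p\<in>P. k -` p) = UNIV" for k :: "cantor \<Rightarrow> cantor"
    using P'(5) by (metis vimage_UNIV vimage_Union)
  have gp: "g -` p = p" if "p \<in> P" for p
  proof -
    have "(\<Union>p'\<in>P. g -` p \<inter> g -` f -` p') = (\<Union>p'\<in>P. p \<inter> h -` p')"
      using g2[OF that] by simp
    moreover have "(\<Union>p'\<in>P. g -` p \<inter> g -` f -` p') = g -` p" "(\<Union>p'\<in>P. p \<inter> h -` p') = p"
      using cover[of "f \<circ> g"] cover[of h] by (simp_all add: vimage_comp flip: Int_UN_distrib)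
    ultimately show ?thesis by simp
  qed
  have gf: "g -` f -` p' = h -` p'" if "p' \<in> P" for p'
  proof -
    have "(\<Union>p\<in>P. g -` p \<inter> g -` f -` p') = (\<Union>p\<in>P. p \<inter> h -` p')"
      using g2[OF _ that] by simp
    moreover have "(\<Union>p\<in>P. g -` p \<inter> g -` f -` p') = g -` f -` p'" "(\<Union>p\<in>P. p \<inter> h -` p') = h -` p'"
      using cover[of g] cover[of id] by (simp_all flip: UN_extend_simps(4))
    ultimately show ?thesis by simp
  qed
  have "conj_map g h -` p = f -` p" if "p \<in> P" for p
  proof -
    have "conj_map g h -` p = inv_into UNIV g -` h -` g -` p"
      by (simp add: conj_map_def vimage_comp o_assoc)
    also have "\<dots> = inv_into UNIV g -` g -` f -` p"
      using gp gf that by simp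
    also have "\<dots> = f -` p"
      using g(1) by auto
    finally show ?thesis .
  qed
  then show thesis using that[OF g(1)] by blast
qed

text \<open>The matrix of the conjugate over \<open>P\<close> is that of \<open>x\<close> over the
  pullback of \<open>P\<close> under \<open>k\<close>. As \<open>Q\<close> refines this pullback,
  the morphism sends \<open>q\<close> to the part whose preimage contains it.\<close>

lemma morphism_of_refinement:
  assumes x: "x \<in> homeo \<mu>" and k: "k \<in> homeo \<mu>" and P: "clopen_partition P" and Q: "clopen_partition Q"
    and r: "realises \<mu> (conj_map k x) (P, a)"
    and ref: "\<And>p q. p \<in> P \<Longrightarrow> q \<in> Q \<Longrightarrow> q \<subseteq> k -` p \<or> q \<inter> k -` p = {}"
  shows "matrix_morphisms \<mu> (Q, matrix_of \<mu> x Q) (P, a) \<noteq> {}"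
proof -
  note P' = clopen_partitionD[OF P] and Q' = clopen_partitionD[OF Q]
  have "\<forall>q\<in>Q. \<exists>p\<in>P. q \<subseteq> k -` p"
  proof
    fix q assume q: "q \<in> Q"
    then obtain t where t: "t \<in> q" using Q'(3) by blast
    obtain p where "p \<in> P" "k t \<in> p" using clopen_partition_cover[OF P] .
    then show "\<exists>p\<in>P. q \<subseteq> k -` p" using ref[of p q] q t by blast
  qed
  then obtain f where f: "\<And>q. q \<in> Q \<Longrightarrow> f q \<in> P" "\<And>q. q \<in> Q \<Longrightarrow> q \<subseteq> k -` f q"
    by metis
  have fib: "{q\<in>Q. restrict f Q q = p} = {q\<in>Q. q \<subseteq> k -` p}" if p: "p \<in> P" for p
  proof -
    have "f q = p" if q: "q \<in> Q" "q \<subseteq> k -` p" for q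
    proof -
      obtain t where t: "t \<in> q" using Q'(3) q(1) by blast
      then have "k t \<in> f q" "k t \<in> p" using f(2)[OF q(1)] q(2) by auto
      then show ?thesis by (rule P'(6)[OF f(1)[OF q(1)] p])
    qed
    then have "restrict f Q q = p \<longleftrightarrow> q \<subseteq> k -` p" if "q \<in> Q" for q
      using f(2)[OF that] that by (metis restrict_apply')
    then show ?thesis by blast
  qed
  have un: "\<Union>{q\<in>Q. restrict f Q q = p} = k -` p" if p: "p \<in> P" for p
    unfolding fib[OF p] using ref[OF p] by (rule Union_partition_subset[OF Q])
  have "restrict f Q ` Q = P"
  proof
    show "P \<subseteq> restrict f Q ` Q"
    proof
      fix p assume p: "p \<in> P"
      obtain t where "t \<in> p" using P'(3) p by blast
      then have "inv_into UNIV k t \<in> k -` p" using k by simp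
      then have "inv_into UNIV k t \<in> \<Union>{q\<in>Q. restrict f Q q = p}" unfolding un[OF p] .
      then show "p \<in> restrict f Q ` Q" by blast
    qed
  qed (use f in auto)
  moreover have "measure \<mu> p = (\<Sum>q\<in>{q\<in>Q. restrict f Q q = p}. measure \<mu> q)" if p: "p \<in> P" for p
  proof -
    have "measure \<mu> p = measure \<mu> (\<Union>{q\<in>Q. restrict f Q q = p})"
      unfolding un[OF p] using homeo_measure[OF k P'(2)[OF p]] by simp
    also have "\<dots> = (\<Sum>q\<in>{q\<in>Q. restrict f Q q = p}. measure \<mu> q)"
      by (rule measure_Union_partition[OF Q]) auto
    finally show ?thesis .
  qed
  moreover have "a (p, p') = (\<Sum>q\<in>{q\<in>Q. restrict f Q q = p}. \<Sum>q'\<in>{q'\<in>Q. restrict f Q q' = p'}. matrix_of \<mu> x Q (q, q'))"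
    if p: "p \<in> P" "p' \<in> P" for p p'
  proof -
    have "a (p, p') = measure \<mu> (k -` p \<inter> x -` (k -` p'))"
      using r p measure_conj_map[OF k x P'(2)[OF p(1)] P'(2)[OF p(2)]] by (simp add: realises_def)
    also have "\<dots> = (\<Sum>q\<in>{q\<in>Q. restrict f Q q = p}. \<Sum>q'\<in>{q'\<in>Q. restrict f Q q' = p'}. measure \<mu> (q \<inter> x -` q'))"
      unfolding un[OF p(1), symmetric] un[OF p(2), symmetric]
      by (rule measure_Union_vimage_Union[OF x Q]) auto
    also have "\<dots> = (\<Sum>q\<in>{q\<in>Q. restrict f Q q = p}. \<Sum>q'\<in>{q'\<in>Q. restrict f Q q' = p'}. matrix_of \<mu> x Q (q, q'))"
      by (intro sum.cong refl) (simp add: matrix_of_def)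
    finally show ?thesis .
  qed
  moreover have "restrict f Q \<in> Q \<rightarrow>\<^sub>E P"
    using f(1) by simp
  ultimately have "restrict f Q \<in> matrix_morphisms \<mu> (Q, matrix_of \<mu> x Q) (P, a)"
    by (simp add: matrix_morphisms_def measure_morphism_def)
  then show ?thesis by blast
qed

end

section \<open>The compact-open topology\<close>

text \<open>For a subbasic set, choose a clopen \<open>W\<close> between the image of
  \<open>K\<close> and \<open>U\<close>: a map with the same preimage of \<open>W\<close> sends
  \<open>K\<close> into \<open>W\<close>. Finite intersections take unions of the families.\<close>

lemma compact_open_neighbourhood:
  fixes f :: "cantor \<Rightarrow> cantor"
  assumes "generate_topology_on {{f. continuous_on UNIV f \<and> f ` K \<subseteq> U} | K U. compact K \<and> open U} T" "f \<in> T"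
  shows "\<exists>\<W>. finite \<W> \<and> (\<forall>W\<in>\<W>. clopen W) \<and>
    (\<forall>h. continuous_on UNIV h \<longrightarrow> (\<forall>W\<in>\<W>. h -` W = f -` W) \<longrightarrow> h \<in> T)"
  using assms
proof (induction rule: generate_topology_on.induct)
  case (Int S T)
  then obtain \<V> \<W> where "finite \<V>" "\<forall>W\<in>\<V>. clopen W" "finite \<W>" "\<forall>W\<in>\<W>. clopen W"
    "\<forall>h. continuous_on UNIV h \<longrightarrow> (\<forall>W\<in>\<V>. h -` W = f -` W) \<longrightarrow> h \<in> S"
    "\<forall>h. continuous_on UNIV h \<longrightarrow> (\<forall>W\<in>\<W>. h -` W = f -` W) \<longrightarrow> h \<in> T"
    by auto
  then show ?case
    by (intro exI[of _ "\<V> \<union> \<W>"]) auto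
next
  case (UN \<T>)
  then obtain T where "T \<in> \<T>" "f \<in> T" by blast
  with UN.IH[OF this] show ?case by (meson UnionI)
next
  case (Basis T)
  then obtain K U where T: "T = {f. continuous_on UNIV f \<and> f ` K \<subseteq> U}" "compact K" "open U"
    by blast
  have "compact (f ` K)"
    using Basis.prems T by (auto intro: compact_continuous_image continuous_on_subset)
  then obtain W where W: "clopen W" "f ` K \<subseteq> W" "W \<subseteq> U"
    using clopen_between[of "f ` K" U] Basis.prems T by auto
  have "h ` K \<subseteq> U" if "h -` W = f -` W" for h
    using W that by blast
  then show ?case
    using W(1) T(1) by (intro exI[of _ "{W}"]) auto
qed simp

lemma homeo_topology_neighbourhood:
  assumes "openin (homeo_topology \<mu>) T" "f \<in> T"
  obtains \<W> where "finite \<W>" "\<And>W. W \<in> \<W> \<Longrightarrow> clopen W"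
    "\<And>h. h \<in> homeo \<mu> \<Longrightarrow> (\<And>W. W \<in> \<W> \<Longrightarrow> h -` W = f -` W) \<Longrightarrow> h \<in> T"
proof -
  obtain S where S: "openin compact_open_topology S" "T = S \<inter> homeo \<mu>"
    using assms(1) unfolding homeo_topology_def openin_subtopology by blast
  have "\<exists>\<W>. finite \<W> \<and> (\<forall>W\<in>\<W>. clopen W) \<and>
    (\<forall>h. continuous_on UNIV h \<longrightarrow> (\<forall>W\<in>\<W>. h -` W = f -` W) \<longrightarrow> h \<in> S)"
    using S assms(2) unfolding compact_open_topology_def openin_topology_generated_by_iff
    by (intro compact_open_neighbourhood) auto
  then obtain \<W> where "finite \<W>" "\<forall>W\<in>\<W>. clopen W"
    and W: "\<forall>h. continuous_on UNIV h \<longrightarrow> (\<forall>W\<in>\<W>. h -` W = f -` W) \<longrightarrow> h \<in> S"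
    by blast
  moreover have "h \<in> T" if "h \<in> homeo \<mu>" "\<And>W. W \<in> \<W> \<Longrightarrow> h -` W = f -` W" for h
  proof -
    have "continuous_on UNIV h"
      using that(1) homeomorphic_imp_continuous_map[of euclidean euclidean h] by (simp add: homeo_def)
    then show ?thesis using W S(2) that by simp
  qed
  ultimately show thesis by (intro that) auto
qed

text \<open>The preimage of a clopen set under \<open>f\<close> is compact, so each inclusion says
  that \<open>h\<close> maps a compact set into an open one.\<close>

lemma openin_agreeing:
  assumes "continuous_on UNIV f" "finite P" "\<And>p. p \<in> P \<Longrightarrow> clopen p"
  shows "openin (homeo_topology \<mu>) {h \<in> homeo \<mu>. \<forall>p\<in>P. f -` p \<subseteq> h -` p}"
proof -
  have "openin compact_open_topology {h :: cantor \<Rightarrow> cantor. continuous_on UNIV h \<and> (\<forall>p\<in>P. f -` p \<subseteq> h -` p)}"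
    using assms(2,3)
  proof (induction rule: finite_induct)
    case empty
    \<comment> \<open>The empty compact set imposes no condition, which makes the set of all
      continuous maps subbasic.\<close>
    have "openin compact_open_topology {h :: cantor \<Rightarrow> cantor. continuous_on UNIV h \<and> h ` {} \<subseteq> UNIV}"
      unfolding compact_open_topology_def by (rule topology_generated_by_Basis) (use compact_empty open_UNIV in blast)
    then show ?case by simp
  next
    case (insert p P)
    have "compact (f -` p)"
      using clopen_vimage[OF assms(1)] insert.prems by (intro clopen_imp_compact) auto
    moreover have "open p"
      using insert.prems by (simp add: clopen_def)
    ultimately have "openin compact_open_topology {h :: cantor \<Rightarrow> cantor. continuous_on UNIV h \<and> h ` (f -` p) \<subseteq> p}"
      unfolding compact_open_topology_def by (intro topology_generated_by_Basis) blast
    then have "openin compact_open_topology ({h :: cantor \<Rightarrow> cantor. continuous_on UNIV h \<and> h ` (f -` p) \<subseteq> p} \<inter>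
        {h. continuous_on UNIV h \<and> (\<forall>p\<in>P. f -` p \<subseteq> h -` p)})"
      using insert.IH insert.prems by (intro openin_Int) auto
    also have "({h. continuous_on UNIV h \<and> h ` (f -` p) \<subseteq> p} \<inter> {h. continuous_on UNIV h \<and> (\<forall>p\<in>P. f -` p \<subseteq> h -` p)})
       = {h. continuous_on UNIV h \<and> (\<forall>p\<in>insert p P. f -` p \<subseteq> h -` p)}"
      by auto
    finally show ?case .
  qed
  moreover have "{h \<in> homeo \<mu>. \<forall>p\<in>P. f -` p \<subseteq> h -` p}
      = {h. continuous_on UNIV h \<and> (\<forall>p\<in>P. f -` p \<subseteq> h -` p)} \<inter> homeo \<mu>"
    using homeomorphic_imp_continuous_map[of euclidean euclidean] by (auto simp: homeo_def)
  ultimately show ?thesis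
    unfolding homeo_topology_def openin_subtopology by blast
qed

section \<open>Limits of homeomorphisms that stabilise on clopen sets\<close>

text \<open>Coordinate \<open>i\<close> of \<open>g (Suc i)\<close> depends on finitely many
  coordinates of its argument. At a late stage \<open>m\<close> these are already final for
  \<open>f m\<close>, and coordinate \<open>i\<close> of \<open>g m\<close> is final too; there the
  two maps are honest inverses.\<close>

lemma stable_limit_inverse:
  fixes f g :: "nat \<Rightarrow> cantor \<Rightarrow> cantor"
  assumes inv: "\<And>n t. g n (f n t) = t" and cont: "\<And>n. continuous_on UNIV (g n)"
    and f: "\<And>n i t. i < n \<Longrightarrow> f n t i = f (Suc i) t i" and g: "\<And>n i t. i < n \<Longrightarrow> g n t i = g (Suc i) t i"
  shows "g (Suc i) (\<lambda>j. f (Suc j) t j) i = t i"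
proof -
  have "clopen (g (Suc i) -` {s. s i})"
    by (rule clopen_vimage[OF cont clopen_coordinate])
  then obtain N where N: "determined N (g (Suc i) -` {s. s i})"
    using clopen_imp_determined by blast
  define m where "m = max N (Suc i)"
  have "(\<lambda>j. f (Suc j) t j) \<in> g (Suc i) -` {s. s i} \<longleftrightarrow> f m t \<in> g (Suc i) -` {s. s i}"
  proof (rule determinedD[OF N])
    show "f (Suc j) t j = f m t j" if "j < N" for j
      using f[of j m t] that by (simp add: m_def)
  qed
  then have "g (Suc i) (\<lambda>j. f (Suc j) t j) i \<longleftrightarrow> g m (f m t) i"
    using g[of i m "f m t"] by (simp add: m_def)
  then show ?thesis using inv by simp
qed

context good_cantor_measure
begin

text \<open>Coordinate \<open>n\<close> is final from stage \<open>Suc n\<close> on and is read off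
  there to define the limit; images under \<open>f n\<close> are preimages under its inverse, so the
  inverses have a limit in the same way. A clopen set involves finitely many coordinates, so its
  preimage under the limit is that under every late \<open>f n\<close>, whence measure
  preservation.\<close>

lemma stable_limit:
  fixes f :: "nat \<Rightarrow> cantor \<Rightarrow> cantor"
  assumes hom: "\<And>n. f n \<in> homeo \<mu>" and cl: "\<And>n U. U \<in> \<U> n \<Longrightarrow> clopen U"
    and mono: "\<And>n. \<U> n \<subseteq> \<U> (Suc n)" and coord: "\<And>n. {t. t n} \<in> \<U> (Suc n)"
    and stable: "\<And>n U. U \<in> \<U> n \<Longrightarrow> f (Suc n) -` U = f n -` U"
      "\<And>n U. U \<in> \<U> n \<Longrightarrow> f (Suc n) ` U = f n ` U"
  obtains x where "x \<in> homeo \<mu>" "\<And>n U. U \<in> \<U> n \<Longrightarrow> x -` U = f n -` U"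
proof -
  have later: "U \<in> \<U> n \<and> f n -` U = f m -` U \<and> f n ` U = f m ` U" if "m \<le> n" "U \<in> \<U> m" for m n U
    using that by (induction rule: dec_induct) (use mono stable in auto)
  define g where "g n = inv_into UNIV (f n)" for n
  have gh: "g n \<in> homeo \<mu>" for n
    unfolding g_def by (rule homeo_inv[OF hom])
  have gf: "g n (f n t) = t" "f n (g n t) = t" for n t
    using hom by (simp_all add: g_def)
  have gv: "g n -` U = f n ` U" for n U
    using gf by (auto simp: image_iff) metis
  have fc: "f n t i = f (Suc i) t i" and gc: "g n t i = g (Suc i) t i" if "i < n" for n i t
  proof -
    have "f n -` {t. t i} = f (Suc i) -` {t. t i}" "g n -` {t. t i} = g (Suc i) -` {t. t i}"
      unfolding gv using later[of "Suc i" n "{t. t i}"] coord[of i] that by simp_all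
    then show "f n t i = f (Suc i) t i" "g n t i = g (Suc i) t i"
      by auto
  qed
  define x y where "x = (\<lambda>t i. f (Suc i) t i)" and "y = (\<lambda>t i. g (Suc i) t i)"
  have "y (x t) i = t i" for t i
    unfolding x_def y_def by (rule stable_limit_inverse[OF gf(1) homeo_continuous[OF gh] fc gc])
  moreover have "x (y t) i = t i" for t i
    unfolding x_def y_def by (rule stable_limit_inverse[OF gf(2) homeo_continuous[OF hom] gc fc])
  ultimately have inv: "y (x t) = t" "x (y t) = t" for t
    by (simp_all add: fun_eq_iff)
  have cx: "continuous_on UNIV x" "continuous_on UNIV y"
    using homeo_clopen_vimage[OF hom clopen_coordinate] homeo_clopen_vimage[OF gh clopen_coordinate]
    by (auto intro!: continuous_on_UNIV_cantorI simp: x_def y_def vimage_def)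
  have xU: "\<exists>N. \<forall>n\<ge>N. x -` U = f n -` U" if U: "clopen U" for U
  proof -
    obtain N where N: "determined N U"
      using clopen_imp_determined[OF U] by blast
    have "x t \<in> U \<longleftrightarrow> f n t \<in> U" if n: "N \<le> n" for n t
    proof (rule determinedD[OF N])
      show "x t i = f n t i" if "i < N" for i
        using fc[of i n t] that n by (simp add: x_def)
    qed
    then show ?thesis by (intro exI[of _ N]) auto
  qed
  show thesis
  proof (rule that)
    have "measure \<mu> (x -` C) = measure \<mu> C" if "clopen C" for C
      using xU[OF that] homeo_measure[OF hom that] by (metis order_refl)
    then show "x \<in> homeo \<mu>"
      using homeoI[OF cx inv] by blast
    show "x -` U = f n -` U" if U: "U \<in> \<U> n" for n U
    proof -
      obtain N where "\<forall>n\<ge>N. x -` U = f n -` U"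
        using xU[OF cl[OF U]] by blast
      then have "x -` U = f (max N n) -` U" by simp
      then show ?thesis
        using later[of n "max N n" U] U by simp
    qed
  qed
qed

section \<open>Directedness and the Rokhlin property\<close>

lemma directed_step:
  assumes dir: "directed_category (matrix_category (clopen_values \<mu>) \<mu>)"
    and f: "f \<in> homeo \<mu>" and \<U>: "finite \<U>" "\<And>U. U \<in> \<U> \<Longrightarrow> clopen U"
    and A: "A \<in> matrix_objects (clopen_values \<mu>) \<mu>"
  obtains f' k where "f' \<in> homeo \<mu>" "k \<in> homeo \<mu>" "\<And>U. U \<in> \<U> \<Longrightarrow> f' -` U = f -` U"
    "\<And>U. U \<in> \<U> \<Longrightarrow> f' ` U = f ` U" "realises \<mu> (conj_map k f') A"
proof -
  \<comment> \<open>Since \<open>f -` (f ` U) = U\<close>, agreement of preimages of \<open>f ` U\<close> yields agreement of images of \<open>U\<close>.\<close>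
  have "finite (\<U> \<union> image f ` \<U>)" "\<And>U. U \<in> \<U> \<union> image f ` \<U> \<Longrightarrow> clopen U"
    using \<U> homeo_clopen_image(1)[OF f] by auto
  then obtain P where P: "clopen_partition P"
    and ref: "\<And>U p. U \<in> \<U> \<union> image f ` \<U> \<Longrightarrow> p \<in> P \<Longrightarrow> p \<subseteq> U \<or> p \<inter> U = {}"
    using clopen_partition_refining by metis
  obtain R a where Ra: "A = (R, a)" by (cases A)
  have A0: "(P, matrix_of \<mu> f P) \<in> matrix_objects (clopen_values \<mu>) \<mu>"
    by (rule matrix_of_object[OF f P])
  obtain Q b where B: "(Q, b) \<in> matrix_objects (clopen_values \<mu>) \<mu>"
    and m0: "matrix_morphisms \<mu> (Q, b) (P, matrix_of \<mu> f P) \<noteq> {}" and m1: "matrix_morphisms \<mu> (Q, b) A \<noteq> {}"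
    using dir A A0 unfolding directed_category_def matrix_category_def by fastforce
  note Q = matrix_objectsD(1)[OF B] and R = matrix_objectsD(1)[OF A[unfolded Ra]]
  obtain h where h: "h \<in> homeo \<mu>" "realises \<mu> h (Q, b)"
    using ex_realising[OF B] .
  obtain g1 where g1: "g1 \<in> homeo \<mu>" "realises \<mu> (conj_map g1 h) (P, matrix_of \<mu> f P)"
    using m0 realises_along_morphism[OF P Q _ h] by blast
  obtain g3 where g3: "g3 \<in> homeo \<mu>" "realises \<mu> (conj_map g3 h) A"
    using m1 realises_along_morphism[OF R Q _ h] Ra by blast
  obtain g2 where g2: "g2 \<in> homeo \<mu>" "\<And>p. p \<in> P \<Longrightarrow> conj_map g2 (conj_map g1 h) -` p = f -` p"
    using conj_map_agrees_on_partition[OF f conj_map_homeo[OF g1(1) h(1)] P g1(2)] by blast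
  define f' where "f' = conj_map g2 (conj_map g1 h)"
  have f'h: "f' \<in> homeo \<mu>"
    unfolding f'_def by (intro conj_map_homeo g1 g2 h)
  have agree: "f' -` U = f -` U" if "U \<in> \<U> \<union> image f ` \<U>" for U
    unfolding f'_def using ref[OF that] g2(2) by (rule vimage_eq_of_partition[OF P])
  \<comment> \<open>Undo the two conjugations leading from \<open>h\<close> to \<open>f'\<close>,
    then apply the one leading to \<open>A\<close>.\<close>
  define k where "k = g3 \<circ> (inv_into UNIV g1 \<circ> inv_into UNIV g2)"
  have "bij g1" "bij g2" "bij g3" "bij (inv_into UNIV g1)" "bij (inv_into UNIV g2)"
    using homeo_bij homeo_inv(1) g1 g2 g3 by blast+
  then have "conj_map k f' = conj_map g3 h"
    unfolding k_def f'_def by (simp add: conj_map_comp conj_map_inv bij_comp)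
  then have "realises \<mu> (conj_map k f') A"
    using g3(2) by simp
  moreover have "k \<in> homeo \<mu>"
    unfolding k_def by (intro homeo_comp homeo_inv(1) g1 g2 g3)
  moreover have "f' ` U = f ` U" if "U \<in> \<U>" for U
  proof -
    have "f' -` (f ` U) = f -` (f ` U)"
      using that by (intro agree) blast
    then have "f' -` (f ` U) = U"
      using homeo_bij[OF f] by (simp add: bij_is_inj inj_vimage_image_eq)
    then show ?thesis
      using homeo_bij[OF f'h] by (metis bij_is_surj surj_image_vimage_eq)
  qed
  ultimately show thesis
    using f'h agree by (intro that[of f' k]) auto
qed

lemma ex_universal_homeo:
  assumes dir: "directed_category (matrix_category (clopen_values \<mu>) \<mu>)"
    and V: "countable (clopen_values \<mu>)"
  obtains x where "x \<in> homeo \<mu>"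
    "\<And>A. A \<in> matrix_objects (clopen_values \<mu>) \<mu> \<Longrightarrow> \<exists>k\<in>homeo \<mu>. realises \<mu> (conj_map k x) A"
proof -
  let ?Ob = "matrix_objects (clopen_values \<mu>) \<mu>"
  have idh: "id \<in> homeo \<mu>"
    by (rule homeoI[of id id]) auto
  \<comment> \<open>An enumeration by all naturals presupposes at least one object; the matrix of
    the identity provides it.\<close>
  obtain P0 where "clopen_partition P0"
    by (rule clopen_partition_refining[of "{}"]) auto
  from matrix_of_object[OF idh this] have ne: "?Ob \<noteq> {}"
    by (metis empty_iff)
  define A where "A = from_nat_into ?Ob"
  have A: "range A = ?Ob"
    unfolding A_def by (rule range_from_nat_into[OF ne countable_matrix_objects[OF V]])
  \<comment> \<open>A state pairs the current homeomorphism with the clopen sets frozen so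
    far.\<close>
  define good_state where "good_state s \<longleftrightarrow> fst s \<in> homeo \<mu> \<and> finite (snd s) \<and> (\<forall>U\<in>snd s. clopen U)"
    for s :: "(cantor \<Rightarrow> cantor) \<times> cantor set set"
  \<comment> \<open>Two kinds of sets are newly frozen: coordinate \<open>n\<close>, so that the
    limit exists, and the preimages of the parts of \<open>A n\<close> under \<open>k\<close>, so
    that the limit keeps the matrix just achieved.\<close>
  define step where "step n s s' \<longleftrightarrow> snd s \<subseteq> snd s' \<and> {t. t n} \<in> snd s' \<and>
      (\<forall>U\<in>snd s. fst s' -` U = fst s -` U \<and> fst s' ` U = fst s ` U) \<and>
      (\<exists>k\<in>homeo \<mu>. realises \<mu> (conj_map k (fst s')) (A n) \<and> (\<forall>p\<in>fst (A n). k -` p \<in> snd s'))"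
    for n :: nat and s s' :: "(cantor \<Rightarrow> cantor) \<times> cantor set set"
  have "\<exists>s. \<forall>n. good_state (s n) \<and> step n (s n) (s (Suc n))"
  proof (rule dependent_nat_choice)
    show "\<exists>s. good_state s"
      using idh by (intro exI[of _ "(id, {})"]) (simp add: good_state_def)
    fix s n assume s: "good_state s"
    have An: "A n \<in> ?Ob" using A by blast
    obtain f k where f: "f \<in> homeo \<mu>" "\<And>U. U \<in> snd s \<Longrightarrow> f -` U = fst s -` U"
        "\<And>U. U \<in> snd s \<Longrightarrow> f ` U = fst s ` U"
      and k: "k \<in> homeo \<mu>" "realises \<mu> (conj_map k f) (A n)"
      using s directed_step[OF dir, of "fst s" "snd s", OF _ _ _ An] unfolding good_state_def by metis
    have cp: "clopen_partition (fst (A n))"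
      using An matrix_objectsD(1) by (metis prod.collapse)
    let ?s' = "(f, snd s \<union> {{t. t n}} \<union> (\<lambda>p. k -` p) ` fst (A n))"
    have "good_state ?s'"
      using s f(1) clopen_coordinate clopen_partitionD(1,2)[OF cp] homeo_clopen_vimage[OF k(1)]
      by (auto simp: good_state_def)
    moreover have "step n s ?s'"
      using f(2,3) k by (auto simp: step_def)
    ultimately show "\<exists>s'. good_state s' \<and> step n s s'" by blast
  qed
  then obtain s where good: "\<And>n. good_state (s n)" and step: "\<And>n. step n (s n) (s (Suc n))"
    by blast
  obtain x where x: "x \<in> homeo \<mu>" "\<And>n U. U \<in> snd (s n) \<Longrightarrow> x -` U = fst (s n) -` U"
  proof (rule stable_limit[of "\<lambda>n. fst (s n)" "\<lambda>n. snd (s n)"])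
    show "fst (s n) \<in> homeo \<mu>" "U \<in> snd (s n) \<Longrightarrow> clopen U" for n U
      using good[of n] by (auto simp: good_state_def)
    show "snd (s n) \<subseteq> snd (s (Suc n))" "{t. t n} \<in> snd (s (Suc n))" for n
      using step[of n] by (auto simp: step_def)
    show "fst (s (Suc n)) -` U = fst (s n) -` U" "fst (s (Suc n)) ` U = fst (s n) ` U" if "U \<in> snd (s n)" for n U
      using step[of n] that by (auto simp: step_def)
  qed blast
  have "\<exists>k\<in>homeo \<mu>. realises \<mu> (conj_map k x) B" if B: "B \<in> ?Ob" for B
  proof -
    obtain n where n: "B = A n" using A B by blast
    obtain k where k: "k \<in> homeo \<mu>" "realises \<mu> (conj_map k (fst (s (Suc n)))) B"
        "\<And>p. p \<in> fst B \<Longrightarrow> k -` p \<in> snd (s (Suc n))"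
      using step[of n] n by (auto simp: step_def)
    have f: "fst (s (Suc n)) \<in> homeo \<mu>"
      using good[of "Suc n"] by (simp add: good_state_def)
    have cp: "clopen p" if "p \<in> fst B" for p
      using B matrix_objectsD(1) clopen_partitionD(2) that by (metis prod.collapse)
    have "measure \<mu> (p \<inter> conj_map k x -` p') = snd B (p, p')" if p: "p \<in> fst B" "p' \<in> fst B" for p p'
    proof -
      have "measure \<mu> (p \<inter> conj_map k x -` p') = measure \<mu> (k -` p \<inter> x -` (k -` p'))"
        by (rule measure_conj_map[OF k(1) x(1) cp[OF p(1)] cp[OF p(2)]])
      \<comment> \<open>In this formula \<open>x\<close> enters only through its preimage of a
        frozen set, where it agrees with stage \<open>Suc n\<close>.\<close>
      also have "\<dots> = measure \<mu> (p \<inter> conj_map k (fst (s (Suc n))) -` p')"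
        unfolding measure_conj_map[OF k(1) f cp[OF p(1)] cp[OF p(2)]] x(2)[OF k(3)[OF p(2)]] ..
      also have "\<dots> = snd B (p, p')"
        using k(2) p by (simp add: realises_def)
      finally show ?thesis .
    qed
    then show ?thesis
      using k(1) by (auto simp: realises_def)
  qed
  then show thesis using that x(1) by blast
qed

section \<open>Density of a conjugacy class in terms of matrices\<close>

lemma conjugacy_class_homeo: "conjugacy_class (homeo_group \<mu>) x = {conj_map g x | g. g \<in> homeo \<mu>}"
proof -
  have "g \<otimes>\<^bsub>homeo_group \<mu>\<^esub> x \<otimes>\<^bsub>homeo_group \<mu>\<^esub> inv\<^bsub>homeo_group \<mu>\<^esub> g = conj_map g x" if "g \<in> homeo \<mu>" for g
    using homeo_group_inv[OF that] by (simp add: conj_map_def homeo_group_def)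
  then show ?thesis
    unfolding conjugacy_class_def by (auto simp: homeo_group_def) metis+
qed

text \<open>A neighbourhood of \<open>f\<close> is controlled by preimages of finitely many clopen
  sets, hence by a fine enough partition \<open>P\<close>. A conjugate of \<open>x\<close> with the
  matrix of \<open>f\<close> over \<open>P\<close> is conjugated once more to agree with
  \<open>f\<close> there.\<close>

lemma rokhlin_if_universal:
  assumes x: "x \<in> homeo \<mu>"
    and univ: "\<And>A. A \<in> matrix_objects (clopen_values \<mu>) \<mu> \<Longrightarrow> \<exists>k\<in>homeo \<mu>. realises \<mu> (conj_map k x) A"
  shows "rokhlin_property (homeo_group \<mu>) (homeo_topology \<mu>)"
proof -
  have "\<exists>y\<in>conjugacy_class (homeo_group \<mu>) x. y \<in> T"
    if T: "openin (homeo_topology \<mu>) T" "f \<in> T" for f T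
  proof -
    have f: "f \<in> homeo \<mu>"
      using openin_subset[OF T(1)] T(2) by (auto simp: topspace_homeo_topology homeo_group_def)
    obtain \<W> where W: "finite \<W>" "\<And>W. W \<in> \<W> \<Longrightarrow> clopen W"
      and nb: "\<And>h. h \<in> homeo \<mu> \<Longrightarrow> (\<And>W. W \<in> \<W> \<Longrightarrow> h -` W = f -` W) \<Longrightarrow> h \<in> T"
      by (rule homeo_topology_neighbourhood[OF T]) blast
    obtain P where P: "clopen_partition P" and ref: "\<And>U p. U \<in> \<W> \<Longrightarrow> p \<in> P \<Longrightarrow> p \<subseteq> U \<or> p \<inter> U = {}"
      using clopen_partition_refining[OF W] by blast
    obtain k where k: "k \<in> homeo \<mu>" "realises \<mu> (conj_map k x) (P, matrix_of \<mu> f P)"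
      using univ[OF matrix_of_object[OF f P]] by blast
    obtain g where g: "g \<in> homeo \<mu>" "\<And>p. p \<in> P \<Longrightarrow> conj_map g (conj_map k x) -` p = f -` p"
      using conj_map_agrees_on_partition[OF f conj_map_homeo[OF k(1) x] P k(2)] by blast
    have "conj_map g (conj_map k x) \<in> T"
    proof (rule nb)
      show "conj_map g (conj_map k x) -` U = f -` U" if "U \<in> \<W>" for U
        using ref[OF that] g(2) by (rule vimage_eq_of_partition[OF P])
    qed (intro conj_map_homeo g k x)
    moreover have "conj_map g (conj_map k x) = conj_map (g \<circ> k) x"
      using homeo_bij g(1) k(1) by (simp add: conj_map_comp)
    ultimately show ?thesis
      using homeo_comp[OF g(1) k(1)] unfolding conjugacy_class_homeo by auto
  qed
  then have "topspace (homeo_topology \<mu>) \<subseteq> homeo_topology \<mu> closure_of conjugacy_class (homeo_group \<mu>) x"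
    unfolding closure_of_def by blast
  then show ?thesis
    using x closure_of_subset_topspace unfolding rokhlin_property_def
    by (metis homeo_group_def partial_object.select_convs(1) subset_antisym)
qed

text \<open>The homeomorphisms agreeing on \<open>P\<close> with one that realises
  \<open>(P, a)\<close> form an open set, which a dense class meets. What \<open>Q\<close> must
  refine is not the two partitions but their pullbacks under the respective conjugators.\<close>

lemma directed_if_rokhlin:
  assumes "rokhlin_property (homeo_group \<mu>) (homeo_topology \<mu>)"
  shows "directed_category (matrix_category (clopen_values \<mu>) \<mu>)"
proof -
  obtain x where x: "x \<in> homeo \<mu>"
    and dense: "homeo_topology \<mu> closure_of conjugacy_class (homeo_group \<mu>) x = homeo \<mu>"
    using assms unfolding rokhlin_property_def topspace_homeo_topology by (auto simp: homeo_group_def)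
  have ex: "\<exists>k\<in>homeo \<mu>. realises \<mu> (conj_map k x) (P, a)" if A: "(P, a) \<in> matrix_objects (clopen_values \<mu>) \<mu>" for P a
  proof -
    obtain h where h: "h \<in> homeo \<mu>" "realises \<mu> h (P, a)"
      using ex_realising[OF A] .
    note P = matrix_objectsD(1)[OF A]
    let ?T = "{f \<in> homeo \<mu>. \<forall>p\<in>P. h -` p \<subseteq> f -` p}"
    have "openin (homeo_topology \<mu>) ?T"
      using clopen_partitionD(1,2)[OF P] homeo_continuous[OF h(1)] by (intro openin_agreeing) auto
    moreover have "h \<in> homeo_topology \<mu> closure_of conjugacy_class (homeo_group \<mu>) x"
      unfolding dense by (rule h(1))
    moreover have "h \<in> ?T"
      using h(1) by simp
    ultimately have "\<exists>y. y \<in> conjugacy_class (homeo_group \<mu>) x \<and> y \<in> ?T"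
      unfolding in_closure_of by (elim conjE allE[of _ ?T] impE) (intro conjI)
    then obtain y where y: "y \<in> conjugacy_class (homeo_group \<mu>) x" "y \<in> ?T"
      by (elim exE conjE)
    then obtain k where k: "k \<in> homeo \<mu>" "y = conj_map k x"
      unfolding conjugacy_class_homeo by blast
    have "y -` p = h -` p" if "p \<in> P" for p
      using y(2) that by (intro vimage_eq_of_vimage_subset[OF P]) auto
    then have "realises \<mu> y (P, a)"
      using h(2) by (simp add: realises_def)
    then show ?thesis using k by blast
  qed
  have "\<exists>B\<in>matrix_objects (clopen_values \<mu>) \<mu>. matrix_morphisms \<mu> B (P\<^sub>0, a\<^sub>0) \<noteq> {} \<and> matrix_morphisms \<mu> B (P\<^sub>1, a\<^sub>1) \<noteq> {}"
    if A: "(P\<^sub>0, a\<^sub>0) \<in> matrix_objects (clopen_values \<mu>) \<mu>" "(P\<^sub>1, a\<^sub>1) \<in> matrix_objects (clopen_values \<mu>) \<mu>" for P\<^sub>0 a\<^sub>0 P\<^sub>1 a\<^sub>1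
  proof -
    note P0 = matrix_objectsD(1)[OF A(1)] and P1 = matrix_objectsD(1)[OF A(2)]
    obtain k0 k1 where k0: "k0 \<in> homeo \<mu>" "realises \<mu> (conj_map k0 x) (P\<^sub>0, a\<^sub>0)"
      and k1: "k1 \<in> homeo \<mu>" "realises \<mu> (conj_map k1 x) (P\<^sub>1, a\<^sub>1)"
      using ex[OF A(1)] ex[OF A(2)] by blast
    let ?\<U> = "(\<lambda>p. k0 -` p) ` P\<^sub>0 \<union> (\<lambda>p. k1 -` p) ` P\<^sub>1"
    have "finite ?\<U>" "\<And>U. U \<in> ?\<U> \<Longrightarrow> clopen U"
      using clopen_partitionD(1,2)[OF P0] clopen_partitionD(1,2)[OF P1]
        homeo_clopen_vimage[OF k0(1)] homeo_clopen_vimage[OF k1(1)] by auto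
    then obtain Q where Q: "clopen_partition Q" and ref: "\<And>U q. U \<in> ?\<U> \<Longrightarrow> q \<in> Q \<Longrightarrow> q \<subseteq> U \<or> q \<inter> U = {}"
      using clopen_partition_refining by metis
    have "matrix_morphisms \<mu> (Q, matrix_of \<mu> x Q) (P\<^sub>0, a\<^sub>0) \<noteq> {}"
      using ref by (intro morphism_of_refinement[OF x k0(1) P0 Q k0(2)]) blast
    moreover have "matrix_morphisms \<mu> (Q, matrix_of \<mu> x Q) (P\<^sub>1, a\<^sub>1) \<noteq> {}"
      using ref by (intro morphism_of_refinement[OF x k1(1) P1 Q k1(2)]) blast
    ultimately show ?thesis
      using matrix_of_object[OF x Q] by blast
  qed
  then show ?thesis
    by (simp add: directed_category_def matrix_category_def split_paired_all)
qed

end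

theorem theorem4p8:
  fixes V :: "real set" and \<mu> :: "cantor measure"
  assumes "group_like V"
    and "good_measure \<mu>"
    and "clopen_values \<mu> = V"
  shows "directed_category (matrix_category V \<mu>) \<longleftrightarrow>
         rokhlin_property (homeo_group \<mu>) (homeo_topology \<mu>)"
proof -
  interpret good_cantor_measure \<mu>
    by standard fact
  \<comment> \<open>Countability of the entries is what lets the objects be enumerated.\<close>
  have V: "countable (clopen_values \<mu>)"
    using assms(1,3) by (simp add: group_like_def)
  show ?thesis
  proof
    assume "directed_category (matrix_category V \<mu>)"
    then obtain x where "x \<in> homeo \<mu>"
      "\<And>A. A \<in> matrix_objects (clopen_values \<mu>) \<mu> \<Longrightarrow> \<exists>k\<in>homeo \<mu>. realises \<mu> (conj_map k x) A"
      using ex_universal_homeo[OF _ V] assms(3) by metis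
    then show "rokhlin_property (homeo_group \<mu>) (homeo_topology \<mu>)"
      by (rule rokhlin_if_universal)
  next
    assume "rokhlin_property (homeo_group \<mu>) (homeo_topology \<mu>)"
    then show "directed_category (matrix_category V \<mu>)"
      using directed_if_rokhlin assms(3) by simp
  qed
qed

end
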